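(* Define integers $b_3(n)$ by $\sum_{n\ge 0} b_3(n)q^n = \prod_{i\ge 1}\frac{1-q^{3i}}{1-q^{i}}$ (the $3$-regular partition function), and set $b_3(m)=0$ for $m<0$. Then: (i) the sequence $\{b_3(2n)\}_{n\ge 0}$ is lacunary modulo $2$, i.e. $\lim_{x\to\infty}\frac{1}{x}\#\{n\le x : b_3(2n)\text{ odd}\}=0$; (ii) if $p$ is a prime with $p\equiv 13,17,19,$ or $23 \pmod{24}$, and $c$ denotes an integer with $24c\equiv 1 \pmod{p^2}$, then $$b_3\bigl(2(p^2 n + kp - c)\bigr)\equiv 0 \pmod 2$$ for all integers $n\ge 0$ and all $1\le k\le p-1$.
   Context: $b_3(n)$ counts partitions of $n$ with no part divisible by $3$. Since $c$ is determined modulo $p^2$ and $n$ ranges over all nonnegative integers, the congruence in (ii) concerns the residue class $kp-c$ modulo $p^2$; arguments that are negative give $b_3=0$. *)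

theory Defs
  imports "HOL-Analysis.Analysis" "HOL-Number_Theory.Number_Theory"
begin

text \<open>
  The product is taken in the \<open>X\<close>-adic topology of \<^typ>\<open>rat fps\<close>; the index is shifted so that
  it starts at \<open>1\<close>.  Rational coefficients are used only because the library's division of
  power series needs a field: lemma \<open>fps_nth_gf3\<close> below shows that the coefficients are
  integers, so that \<open>b3\<close> is well defined.
\<close>

definition gf3 :: "rat fps" where
  "gf3 = (\<Prod>i. (1 - fps_X ^ (3 * Suc i)) / (1 - fps_X ^ Suc i))"

definition b3 :: "int \<Rightarrow> int" where
  "b3 m = (if m < 0 then 0 else (THE z. of_int z = fps_nth gf3 (nat m)))"

definition lacunary_mod :: "int \<Rightarrow> (nat \<Rightarrow> int) \<Rightarrow> bool" where
  "lacunary_mod M a \<longleftrightarrow>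
     ((\<lambda>x::real. 1 / x * real (card {n::nat. real n \<le> x \<and> \<not> M dvd a n})) \<longlongrightarrow> 0) at_top"

lemma gf3_factor:
  "(1 - fps_X ^ (3 * Suc i)) / (1 - fps_X ^ Suc i) = (1 + fps_X ^ Suc i * (1 + fps_X ^ Suc i) :: rat fps)"
proof -
  define y :: "rat fps" where "y = fps_X ^ Suc i"
  have nz: "1 - y \<noteq> 0"
  proof
    assume "1 - y = 0"
    hence "fps_nth (1 - y) 0 = 0" by simp
    thus False by (simp add: y_def)
  qed
  have "(1 - y ^ 3) = (1 + y * (1 + y)) * (1 - y)"
    by (simp add: algebra_simps power3_eq_cube)
  moreover have "fps_X ^ (3 * Suc i) = y ^ 3"
    unfolding y_def power_mult[symmetric] by (simp only: mult.commute)
  ultimately show ?thesis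
    unfolding y_def[symmetric] using nz by (metis nonzero_mult_div_cancel_right)
qed

lemma gf3_has_prod_aux:
  fixes f :: "nat \<Rightarrow> rat fps"
  assumes f: "\<And>i. f i = 1 + fps_X ^ Suc i * (1 + fps_X ^ Suc i)"
  shows "\<exists>L. f has_prod L \<and> (\<forall>m. fps_nth L m \<in> \<int>)"
proof -
  define P where "P = (\<lambda>n. \<Prod>i\<le>n. f i)"
  define L where "L = Abs_fps (\<lambda>m. fps_nth (P m) m)"
  have PSuc: "P (Suc n) = P n + fps_X ^ Suc (Suc n) * (P n * (1 + fps_X ^ Suc (Suc n)))" for n
    by (simp add: P_def f algebra_simps)
  have step: "fps_nth (P (Suc n)) m = fps_nth (P n) m" if "m \<le> n" for n m
    unfolding PSuc fps_add_nth fps_X_power_mult_nth using that by simp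
  have stab: "fps_nth (P n) m = fps_nth (P m) m" if "m \<le> n" for n m
    using that by (induction n rule: dec_induct) (simp_all add: step)
  have lim: "P \<longlonglongrightarrow> L"
  proof (rule tendsto_fpsI)
    fix m
    show "\<forall>\<^sub>F n in sequentially. fps_nth (P n) m = fps_nth L m"
      using eventually_ge_at_top[of m] unfolding L_def fps_nth_Abs_fps by eventually_elim (rule stab)
  qed
  have "fps_nth L 0 = 1"
    by (simp add: L_def P_def f)
  hence "L \<noteq> 0" by auto
  hence "f has_prod L"
    using lim by (simp add: has_prod_def raw_has_prod_def P_def)
  moreover have "\<forall>m. fps_nth (P n) m \<in> \<int>" for n
  proof (induction n)
    case 0
    have "P 0 = 1 + fps_X + fps_X * fps_X"
      by (simp add: P_def f algebra_simps)
    thus ?case by auto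
  next
    case (Suc n)
    show ?case
    proof
      fix m
      show "fps_nth (P (Suc n)) m \<in> \<int>"
        unfolding PSuc fps_add_nth fps_X_power_mult_nth distrib_left fps_X_power_mult_right_nth mult_1_right
        using Suc by auto
    qed
  qed
  ultimately show ?thesis by (auto simp: L_def)
qed

lemma has_prod_gf3: "(\<lambda>i. (1 - fps_X ^ (3 * Suc i)) / (1 - fps_X ^ Suc i)) has_prod gf3"
proof -
  obtain L where L: "(\<lambda>i. 1 + fps_X ^ Suc i * (1 + fps_X ^ Suc i) :: rat fps) has_prod L"
    using gf3_has_prod_aux[OF refl] by blast
  show ?thesis
    unfolding gf3_def gf3_factor has_prod_unique[OF L, symmetric] by (rule L)
qed

lemma fps_nth_gf3: "fps_nth gf3 n = of_int (b3 (int n))"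
proof -
  obtain L where L: "(\<lambda>i. 1 + fps_X ^ Suc i * (1 + fps_X ^ Suc i) :: rat fps) has_prod L"
      "\<forall>m. fps_nth L m \<in> \<int>"
    using gf3_has_prod_aux[OF refl] by blast
  have "gf3 = L"
    unfolding gf3_def gf3_factor has_prod_unique[OF L(1), symmetric] ..
  then obtain z where z: "fps_nth gf3 n = of_int z"
    using L(2) by (auto elim: Ints_cases)
  have "(THE z. of_int z = fps_nth gf3 n) = z"
    by (rule the_equality) (auto simp: z)
  thus ?thesis by (simp add: b3_def z)
qed

end

theory Submission
  imports Defs "HOL-Library.Z2"
begin

text \<open>
  Write \<open>f_k = \<Prod>(1 - q^{ki})\<close>.  Modulo 2 we have \<open>f_k^2 = f_{2k}\<close>, and the Jacobi triple product
  shows that \<open>f_3^3/f_1 = \<Sum> q^{n(3n+2)}\<close>.  Taking even parts in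
  \<open>f_3/f_1 = (1/f_6) (f_3^3/f_1)\<close> gives \<open>\<Sum> b_3(2n) q^n = f_4/f_3\<close>.  The theta series
  \<open>f_4/f_1 = \<Sum> q^{n(2n-1)}\<close>, split according to \<open>n mod 3\<close>, turns this into
  \<open>f_1 (1 + \<Sum> q^{(3n+1)^2})\<close>.  With the pentagonal number theorem, \<open>b_3(2n)\<close> can therefore be
  odd only if \<open>24n + 1 = u^2 + 24v^2\<close>.

  For \<open>p = 13, 17, 19, 23 (mod 24)\<close> the number \<open>-6\<close> is a non-residue (by Thue's lemma), so no
  number \<open>u^2 + 24v^2\<close> is divisible by \<open>p\<close> exactly once, which is (ii).  For (i) we sieve by this
  condition for finitely many such \<open>p\<close>; the density can be made arbitrarily small because the
  sum of \<open>1/p\<close> over these primes diverges.  The divergence follows from \<open>\<zeta>(s) \<rightarrow> \<infinity>\<close> as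
  \<open>s \<rightarrow> 1\<close> by comparing \<open>\<zeta>\<close> with the \<open>L\<close>-series of the character of \<open>\<rat>(\<surd>-6)\<close>, for which an
  upper bound suffices.
\<close>

section \<open>Infinite products over the field with two elements\<close>

text \<open>Each coefficient of a product involves only finitely many coefficients of the factors,
  and each of these is eventually constant.\<close>

lemma tendsto_mult_fps:
  fixes F G :: "'a::comm_ring_1 fps"
  assumes "(f \<longlongrightarrow> F) A" "(g \<longlongrightarrow> G) A"
  shows "((\<lambda>x. f x * g x) \<longlongrightarrow> F * G) A"
proof (rule tendsto_fpsI)
  fix n
  have "eventually (\<lambda>x. \<forall>i\<in>{0..n}. fps_nth (f x) i = fps_nth F i) A"
    "eventually (\<lambda>x. \<forall>i\<in>{0..n}. fps_nth (g x) i = fps_nth G i) A"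
    using assms by (auto simp: tendsto_fps_iff intro!: eventually_ball_finite)
  thus "eventually (\<lambda>x. fps_nth (f x * g x) n = fps_nth (F * G) n) A"
    by eventually_elim (auto simp: fps_mult_nth intro!: sum.cong)
qed

lemma bit_fps_add_self [simp]: "f + f = 0" for f :: "bit fps"
  by (rule fps_ext) (metis fps_add_nth fps_zero_nth mult_2 bit_2_eq_0 mult_zero_left)

lemma bit_fps_diff: "f - g = f + g" for f :: "bit fps"
  by (rule fps_ext) simp

lemma bit_fps_add_power2: "(f + g)\<^sup>2 = f\<^sup>2 + g\<^sup>2" for f :: "bit fps"
proof -
  have "(f + g)\<^sup>2 = f\<^sup>2 + g\<^sup>2 + (f * g + f * g)"
    by (simp only: power2_eq_square distrib_left distrib_right ac_simps)
  thus ?thesis by (simp only: bit_fps_add_self add_0_right)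
qed

text \<open>This is the infinite product of the factors \<open>1 + q^(A i + B)\<close> over
  \<open>i \<ge> 0\<close>. For positive \<open>A\<close> and \<open>B\<close> the first
  \<open>m\<close> factors fix coefficient \<open>m\<close>, as every later exponent exceeds
  \<open>m\<close>. Signs disappear over \<open>bit\<close>, so \<open>xprod k k\<close> is Euler's
  product \<open>f_k\<close>.\<close>

definition xprod :: "nat \<Rightarrow> nat \<Rightarrow> bit fps" where
  "xprod A B = Abs_fps (\<lambda>m. fps_nth (\<Prod>i<m. 1 + fps_X ^ (A * i + B)) m)"

lemma xprod_nth:
  assumes "A > 0" "B > 0" "m \<le> N"
  shows "fps_nth (\<Prod>i<N. 1 + fps_X ^ (A * i + B)) m = fps_nth (xprod A B) m"
  using assms(3)
proof (induction N rule: dec_induct)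
  case base
  show ?case by (simp add: xprod_def)
next
  case (step N)
  have "N \<le> A * N" using assms by simp
  hence "m < A * N + B" using assms step.hyps by linarith
  thus ?case using step.IH by (simp add: distrib_left fps_X_power_mult_right_nth)
qed

lemma xprod_LIMSEQ:
  assumes "A > 0" "B > 0"
  shows "(\<lambda>N. \<Prod>i<N. 1 + fps_X ^ (A * i + B)) \<longlonglongrightarrow> xprod A B"
proof (rule tendsto_fpsI)
  fix n
  show "\<forall>\<^sub>F N in sequentially. fps_nth (\<Prod>i<N. 1 + fps_X ^ (A * i + B)) n = fps_nth (xprod A B) n"
    using eventually_ge_at_top[of n] by eventually_elim (rule xprod_nth[OF assms])
qed

lemma xprod_nth_0 [simp]: "fps_nth (xprod A B) 0 = 1"
  by (simp add: xprod_def)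

lemma xprod_nonzero [simp]: "xprod A B \<noteq> 0"
  using xprod_nth_0[of A B] by (metis fps_zero_nth zero_neq_one)

text \<open>Squaring is additive in characteristic 2, so it doubles the exponents in every
  factor.\<close>

lemma xprod_power2:
  assumes "A > 0" "B > 0"
  shows "(xprod A B)\<^sup>2 = xprod (2 * A) (2 * B)"
proof (rule LIMSEQ_unique)
  show "(\<lambda>N. (\<Prod>i<N. 1 + fps_X ^ (A * i + B)) * (\<Prod>i<N. 1 + fps_X ^ (A * i + B))) 
     \<longlonglongrightarrow> (xprod A B)\<^sup>2"
    unfolding power2_eq_square by (intro tendsto_mult_fps xprod_LIMSEQ assms)
  have "(1 + fps_X ^ (A * i + B) :: bit fps)\<^sup>2 = 1 + fps_X ^ (2 * A * i + 2 * B)" for i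
    unfolding bit_fps_add_power2 by (simp add: algebra_simps flip: power_mult)
  hence "(\<Prod>i<N. 1 + fps_X ^ (A * i + B)) * (\<Prod>i<N. 1 + fps_X ^ (A * i + B)) =
     (\<Prod>i<N. 1 + fps_X ^ (2 * A * i + 2 * B) :: bit fps)" for N
    by (simp only: prod_power_distrib power2_eq_square[symmetric])
  thus "(\<lambda>N. (\<Prod>i<N. 1 + fps_X ^ (A * i + B)) * (\<Prod>i<N. 1 + fps_X ^ (A * i + B))) 
     \<longlonglongrightarrow> xprod (2 * A) (2 * B)"
    using assms by (simp add: xprod_LIMSEQ)
qed

lemma tendsto_prod_fps_finite:
  fixes F :: "'i \<Rightarrow> 'a::comm_ring_1 fps"
  assumes "\<And>j. j \<in> J \<Longrightarrow> (f j \<longlongrightarrow> F j) A"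
  shows "((\<lambda>x. \<Prod>j\<in>J. f j x) \<longlongrightarrow> (\<Prod>j\<in>J. F j)) A"
  using assms by (induction J rule: infinite_finite_induct) (auto intro!: tendsto_mult_fps)

text \<open>The factors are sorted by the residue of their index modulo \<open>r\<close>.\<close>

lemma xprod_split:
  assumes "A > 0" "B > 0" "r > 0"
  shows "xprod A B = (\<Prod>j<r. xprod (r * A) (A * j + B))"
proof (rule LIMSEQ_unique)
  have "strict_mono (\<lambda>N. N * r)" using assms by (auto simp: strict_mono_def)
  from LIMSEQ_subseq_LIMSEQ[OF xprod_LIMSEQ[OF assms(1,2)] this]
  show "(\<lambda>N. \<Prod>i<N*r. 1 + fps_X ^ (A * i + B)) \<longlonglongrightarrow> xprod A B"
    by (simp add: o_def)
  have "(\<Prod>i<N*r. 1 + fps_X ^ (A * i + B)) =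
     (\<Prod>j<r. \<Prod>i<N. 1 + fps_X ^ (r * A * i + (A * j + B)) :: bit fps)" for N
  proof -
    have "(\<Prod>i<N*r. 1 + fps_X ^ (A * i + B) :: bit fps) = 
       (\<Prod>i<N. \<Prod>j\<in>{i*r..<i*r+r}. 1 + fps_X ^ (A * j + B))"
      by (simp add: prod.nat_group)
    also have "\<dots> = (\<Prod>i<N. \<Prod>j<r. 1 + fps_X ^ (r * A * i + (A * j + B)))"
    proof (rule prod.cong[OF refl])
      fix i
      show "(\<Prod>j\<in>{i*r..<i*r+r}. 1 + fps_X ^ (A * j + B) :: bit fps) = 
         (\<Prod>j<r. 1 + fps_X ^ (r * A * i + (A * j + B)))"
        by (rule prod.reindex_bij_witness[of _ "\<lambda>j. j + i * r" "\<lambda>j. j - i * r"])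
           (auto simp: le_iff_add algebra_simps)
    qed
    also have "\<dots> = (\<Prod>j<r. \<Prod>i<N. 1 + fps_X ^ (r * A * i + (A * j + B)))"
      by (rule prod.swap)
    finally show ?thesis .
  qed
  moreover have "(\<lambda>N. \<Prod>j<r. \<Prod>i<N. 1 + fps_X ^ (r * A * i + (A * j + B)) :: bit fps) 
      \<longlonglongrightarrow> (\<Prod>j<r. xprod (r * A) (A * j + B))"
    using assms by (intro tendsto_prod_fps_finite xprod_LIMSEQ) auto
  ultimately show "(\<lambda>N. \<Prod>i<N*r. 1 + fps_X ^ (A * i + B)) \<longlonglongrightarrow> (\<Prod>j<r. xprod (r * A) (A * j + B))"
    by simp
qed

section \<open>The Jacobi triple product modulo 2\<close>

fun gauss_binom :: "'a::comm_ring_1 \<Rightarrow> nat \<Rightarrow> nat \<Rightarrow> 'a" where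
  "gauss_binom q M 0 = 1"
| "gauss_binom q 0 (Suc k) = 0"
| "gauss_binom q (Suc M) (Suc k) = gauss_binom q M (Suc k) + q ^ (M - k) * gauss_binom q M k"

lemma gauss_binom_eq_0: "M < k \<Longrightarrow> gauss_binom q M k = 0"
  by (induction q M k rule: gauss_binom.induct) auto

lemma tri_Suc: "Suc k * (Suc k - 1) div 2 = k * (k - 1) div 2 + k"
proof (cases k)
  case (Suc j)
  have "Suc k * (Suc k - 1) = k * (k - 1) + k * 2" by (simp add: Suc)
  thus ?thesis by simp
qed simp

text \<open>Rothe's q-binomial theorem, by induction on the number of factors. The form homogeneous
  in \<open>x\<close> and \<open>y\<close> allows a positive power of \<open>q\<close> to be put for
  \<open>y\<close> later, where the usual form would need a negative power for
  \<open>x\<close>.\<close>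

lemma gauss_binom_theorem:
  "(\<Prod>i<M. y + x * q ^ i) = 
     (\<Sum>k\<le>M. gauss_binom q M k * q ^ (k * (k - 1) div 2) * x ^ k * y ^ (M - k))"
proof (induction M)
  case (Suc M)
  define t where "t k = k * (k - 1) div 2" for k :: nat
  have t: "t (Suc k) = t k + k" for k unfolding t_def by (rule tri_Suc)
  have t0: "t 0 = 0" by (simp add: t_def)
  let ?g = "gauss_binom q"
  have "(\<Prod>i<Suc M. y + x * q ^ i) = 
     y * (\<Sum>k\<le>M. ?g M k * q ^ t k * x ^ k * y ^ (M - k)) + 
     x * q ^ M * (\<Sum>k\<le>M. ?g M k * q ^ t k * x ^ k * y ^ (M - k))"
    using Suc by (simp add: t_def algebra_simps)
  also have "y * (\<Sum>k\<le>M. ?g M k * q ^ t k * x ^ k * y ^ (M - k)) = 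
       (\<Sum>k\<le>Suc M. ?g M k * q ^ t k * x ^ k * y ^ (Suc M - k))"
    by (auto simp: sum_distrib_left gauss_binom_eq_0 Suc_diff_le intro!: sum.cong)
  also have "\<dots> = y ^ Suc M + (\<Sum>k\<le>M. ?g M (Suc k) * q ^ t (Suc k) * x ^ Suc k * y ^ (M - k))"
    by (subst sum.atMost_Suc_shift) (simp add: t0)
  also have "x * q ^ M * (\<Sum>k\<le>M. ?g M k * q ^ t k * x ^ k * y ^ (M - k)) =
      (\<Sum>k\<le>M. q ^ (M - k) * ?g M k * q ^ t (Suc k) * x ^ Suc k * y ^ (M - k))"
    unfolding sum_distrib_left
  proof (rule sum.cong[OF refl])
    fix k assume "k \<in> {..M}"
    hence "q ^ M = q ^ (M - k) * q ^ k" by (simp flip: power_add)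
    thus "x * q ^ M * (?g M k * q ^ t k * x ^ k * y ^ (M - k)) = 
        q ^ (M - k) * ?g M k * q ^ t (Suc k) * x ^ Suc k * y ^ (M - k)"
      by (simp add: t power_add algebra_simps)
  qed
  also have "y ^ Suc M + (\<Sum>k\<le>M. ?g M (Suc k) * q ^ t (Suc k) * x ^ Suc k * y ^ (M - k)) + \<dots> =
     y ^ Suc M + (\<Sum>k\<le>M. ?g (Suc M) (Suc k) * q ^ t (Suc k) * x ^ Suc k * y ^ (M - k))"
    by (simp add: algebra_simps sum.distrib)
  also have "\<dots> = (\<Sum>k\<le>Suc M. ?g (Suc M) k * q ^ t k * x ^ k * y ^ (Suc M - k))"
    by (subst sum.atMost_Suc_shift[of _ M]) (simp add: t0)
  finally show ?case by (simp only: t_def)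
qed simp

text \<open>The quotient formula for Gaussian binomials, cleared of denominators so that it makes
  sense in every commutative ring.\<close>

lemma gauss_binom_mult_prod:
  assumes "k \<le> M"
  shows "gauss_binom q M k * (\<Prod>i<k. 1 - q ^ Suc i) * (\<Prod>i<M-k. 1 - q ^ Suc i) = (\<Prod>i<M. 1 - q ^ Suc i)"
  using assms
proof (induction M arbitrary: k)
  case (Suc M k)
  define d where "d n = (\<Prod>i<n. 1 - q ^ Suc i)" for n
  have d: "d (Suc n) = d n * (1 - q ^ Suc n)" for n by (simp add: d_def)
  show ?case unfolding d_def[symmetric]
  proof (cases k)
    case 0
    thus "gauss_binom q (Suc M) k * d k * d (Suc M - k) = d (Suc M)"
      by (simp add: d_def)
  next
    case k: (Suc j)
    have A: "gauss_binom q M j * d j * d (M - j) = d M"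
      using Suc k unfolding d_def by simp
    \<comment> \<open>For \<open>j = M\<close> both sides vanish: the coefficient lies outside the
      triangle, and \<open>1 - q ^ 0 = 0\<close>.\<close>
    have B: "gauss_binom q M k * d k * d (M - j) = d M * (1 - q ^ (M - j))"
    proof (cases "j = M")
      case False
      hence le: "k \<le> M" and e: "M - j = Suc (M - k)" using k Suc.prems by auto
      have "gauss_binom q M k * d k * d (M - k) = d M"
        using Suc.IH[OF le] unfolding d_def by simp
      thus ?thesis unfolding e d by (metis mult.assoc)
    qed (simp add: gauss_binom_eq_0 k)
    have "gauss_binom q (Suc M) k * d k * d (Suc M - k) =
       gauss_binom q M k * d k * d (M - j) + q ^ (M - j) * (1 - q ^ Suc j) * (gauss_binom q M j * d j * d (M - j))"
      by (simp add: k d algebra_simps)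
    also have "\<dots> = d M * (1 - q ^ (M - j) * q ^ Suc j)"
      unfolding A B by (simp add: algebra_simps)
    also have "q ^ (M - j) * q ^ Suc j = q ^ Suc M"
      using Suc.prems k by (simp flip: power_add power_Suc)
    finally show "gauss_binom q (Suc M) k * d k * d (Suc M - k) = d (Suc M)"
      by (simp only: d)
  qed
qed simp

text \<open>The equation for \<open>n\<close> is that of the exponent \<open>A n(n-1)/2 + B n\<close>, doubled to avoid a division.\<close>

definition theta :: "nat \<Rightarrow> nat \<Rightarrow> bit fps" where
  "theta A B = Abs_fps (\<lambda>m. of_nat (card {n::int. int A * n * (n - 1) + 2 * int B * n = 2 * int m}))"

definition theta_exp :: "nat \<Rightarrow> nat \<Rightarrow> int \<Rightarrow> int" where
  "theta_exp A B n = int A * (n * (n - 1) div 2) + int B * n"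

lemma theta_exp_eq: "2 * theta_exp A B n = int A * n * (n - 1) + 2 * int B * n"
proof -
  have "2 * (n * (n - 1) div 2) = n * (n - 1)" by (rule dvd_mult_div_cancel) auto
  thus ?thesis by (simp add: theta_exp_def algebra_simps)
qed

lemma theta_nth: "fps_nth (theta A B) m = of_nat (card {n. theta_exp A B n = int m})"
proof -
  have "theta_exp A B n = int m \<longleftrightarrow> int A * n * (n - 1) + 2 * int B * n = 2 * int m" for n
    using theta_exp_eq[of A B n] by linarith
  thus ?thesis by (simp add: theta_def)
qed

text \<open>Hence the solution sets counted in \<open>theta\<close> are finite, so that
  \<open>card\<close> is a true count, and coefficient \<open>m\<close> depends only on the
  \<open>n\<close> with \<open>|n| \<le> m\<close>.\<close>

lemma theta_exp_ge:
  assumes "0 < B" "B < A"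
  shows "\<bar>n\<bar> \<le> theta_exp A B n"
proof (cases "n \<ge> 0")
  case True
  have "n * (n - 1) \<ge> 0" using True by (cases "n = 0") auto
  hence "int A * (n * (n - 1) div 2) \<ge> 0" by (simp add: pos_imp_zdiv_nonneg_iff)
  moreover have "1 * n \<le> int B * n" using True assms by (intro mult_right_mono) auto
  ultimately show ?thesis using True by (simp add: theta_exp_def)
next
  case False
  define m where "m = - n"
  have m: "m > 0" using False by (simp add: m_def)
  have "n * (n - 1) = m * (m + 1)" by (simp add: m_def algebra_simps)
  moreover have "m * 2 \<le> m * (m + 1)" using m by (intro mult_left_mono) auto
  ultimately have "m \<le> n * (n - 1) div 2" by simp
  hence "int A * m \<le> int A * (n * (n - 1) div 2)" by (intro mult_left_mono) auto
  hence "(int A - int B) * m \<le> theta_exp A B n" by (simp add: theta_exp_def m_def algebra_simps)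
  moreover have "1 * m \<le> (int A - int B) * m" using assms m by (intro mult_right_mono) auto
  ultimately have "m \<le> theta_exp A B n" by linarith
  thus ?thesis using m by (simp add: m_def)
qed

section \<open>From the finite to the infinite triple product\<close>

lemma dvd_fps_X_power_iff:
  "fps_X ^ M dvd (f :: 'a::field fps) \<longleftrightarrow> (\<forall>j<M. fps_nth f j = 0)"
proof
  assume "fps_X ^ M dvd f"
  then obtain g where "f = fps_X ^ M * g" by (elim dvdE)
  thus "\<forall>j<M. fps_nth f j = 0" by (simp add: fps_X_power_mult_nth)
next
  assume "\<forall>j<M. fps_nth f j = 0"
  hence "f = fps_X ^ M * fps_shift M f" 
    by (intro fps_ext) (simp add: fps_X_power_mult_nth)
  thus "fps_X ^ M dvd f" by (metis dvd_triv_left)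
qed

text \<open>As \<open>k\<close> and \<open>K - k\<close> grow, the Gaussian binomial tends to the
  reciprocal of the Euler product. In the quotient formula each of the three finite products agrees
  with \<open>D\<close> modulo \<open>fps_X ^ M\<close>, and \<open>D\<close> is a unit.\<close>

lemma gauss_binom_nth:
  assumes "A > 0" "j < M" "M \<le> k" "k + M \<le> K"
  shows "fps_nth (gauss_binom (fps_X ^ A) K k * xprod A A) j = fps_nth 1 j"
proof -
  define d where "d n = (\<Prod>i<n. 1 - (fps_X ^ A) ^ Suc i :: bit fps)" for n
  define D where "D = xprod A A"
  define g where "g = gauss_binom (fps_X ^ A :: bit fps) K k"
  have dD: "fps_X ^ M dvd d n - D" if "M \<le> n" for n
  proof -
    have "d n = (\<Prod>i<n. 1 + fps_X ^ (A * i + A))"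
      unfolding d_def bit_fps_diff by (simp add: mult.commute add.commute flip: power_mult power_Suc)
    thus ?thesis using that assms(1)
      by (simp add: dvd_fps_X_power_iff D_def xprod_nth)
  qed
  have "g * d k * d (K - k) = d K"
    unfolding g_def d_def using assms by (intro gauss_binom_mult_prod) auto
  \<comment> \<open>The finite products are replaced by \<open>D\<close> one at a time; each error
    term has a factor divisible by \<open>fps_X ^ M\<close>.\<close>
  hence "(g * D - 1) * D = (d K - D) - g * (d k - D) * d (K - k) - g * D * (d (K - k) - D)"
    by (simp add: algebra_simps)
  also have "fps_X ^ M dvd \<dots>"
    using assms by (intro dvd_diff dvd_mult dvd_mult2 dD) auto
  finally have "fps_X ^ M dvd (g * D - 1) * D" .
  moreover have "D dvd 1" by (simp add: D_def)
  ultimately have "fps_X ^ M dvd g * D - 1" by (simp add: dvd_mult_unit_iff)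
  hence "fps_nth (g * D - 1) j = 0" using assms(2) unfolding dvd_fps_X_power_iff by blast
  thus ?thesis by (simp only: fps_sub_nth right_minus_eq g_def D_def)
qed

text \<open>The q-binomial theorem is applied to the \<open>2 * N\<close> factors
  \<open>X^(A N) + X^(A i + B)\<close>. Taking the lower power out of each leaves the two products
  on the left, the second one in reverse order. The total power \<open>X ^ s\<close> also divides
  every term of the sum and cancels.\<close>

lemma finite_jacobi:
  assumes "0 < B" "B < A"
  shows "(\<Prod>i<N. 1 + fps_X ^ (A * i + B)) * (\<Prod>i<N. 1 + fps_X ^ (A * i + (A - B))) =
     (\<Sum>k\<le>2*N. gauss_binom (fps_X ^ A) (2 * N) k * fps_X ^ nat (theta_exp A B (int k - int N)) :: bit fps)"
proof -
  define X where "X = (fps_X :: bit fps)"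
  define t where "t k = k * (k - 1) div 2" for k :: nat
  \<comment> \<open>The upper half of the factors contributes \<open>A N\<close> each, the lower
    half \<open>A i + B\<close> each.\<close>
  define s where "s = A * (N * N) + A * t N + B * N"
  have t: "2 * int (t k) = int k * (int k - 1)" for k
  proof -
    have "2 * t k = k * (k - 1)" unfolding t_def by (rule dvd_mult_div_cancel) auto
    hence "2 * int (t k) = int (k * (k - 1))" by (metis of_nat_mult of_nat_numeral)
    thus ?thesis by (cases k) (auto simp: algebra_simps)
  qed
  have "(\<Prod>i<2*N. (X ^ A) ^ N + X ^ B * (X ^ A) ^ i) = 
     (\<Sum>k\<le>2*N. gauss_binom (X ^ A) (2*N) k * (X ^ A) ^ t k * (X ^ B) ^ k * ((X ^ A) ^ N) ^ (2*N - k))"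
    unfolding t_def by (rule gauss_binom_theorem)
  also have "\<dots> = (\<Sum>k\<le>2*N. X ^ s * (gauss_binom (X ^ A) (2*N) k * X ^ nat (theta_exp A B (int k - int N))))"
  proof (rule sum.cong[OF refl])
    fix k assume k: "k \<in> {..2*N}"
    have "int (A * t k + B * k + A * N * (2*N-k)) = int (s + nat (theta_exp A B (int k - int N)))"
    proof -
      have "theta_exp A B (int k - int N) \<ge> 0" using theta_exp_ge[OF assms, of "int k - int N"] by linarith
      \<comment> \<open>Doubling makes the exponents polynomials, free of the division by 2.\<close>
      moreover have "2 * (int A * int (t k) + int B * int k + int A * int N * (2 * int N - int k)) = 
         2 * (int A * (int N * int N) + int A * int (t N) + int B * int N + theta_exp A B (int k - int N))"
        unfolding distrib_left theta_exp_eq mult.left_commute[of 2 "int A"] t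
        by (simp add: algebra_simps)
      ultimately show ?thesis using k by (simp add: s_def of_nat_diff)
    qed
    hence e: "A * t k + B * k + A * N * (2*N-k) = s + nat (theta_exp A B (int k - int N))"
      by (simp only: of_nat_eq_iff)
    have "(X ^ A) ^ t k * (X ^ B) ^ k * ((X ^ A) ^ N) ^ (2*N - k) = X ^ (A * t k + B * k + A * N * (2*N-k))"
      by (simp only: power_add power_mult)
    hence "(X ^ A) ^ t k * (X ^ B) ^ k * ((X ^ A) ^ N) ^ (2*N - k) = X ^ s * X ^ nat (theta_exp A B (int k - int N))"
      by (simp only: e power_add)
    hence "gauss_binom (X ^ A) (2*N) k * ((X ^ A) ^ t k * (X ^ B) ^ k * ((X ^ A) ^ N) ^ (2*N - k)) = 
       gauss_binom (X ^ A) (2*N) k * (X ^ s * X ^ nat (theta_exp A B (int k - int N)))"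
      by (rule arg_cong)
    thus "gauss_binom (X ^ A) (2*N) k * (X ^ A) ^ t k * (X ^ B) ^ k * ((X ^ A) ^ N) ^ (2*N - k) = 
       X ^ s * (gauss_binom (X ^ A) (2*N) k * X ^ nat (theta_exp A B (int k - int N)))"
      by (simp only: mult.assoc mult.left_commute[of "X ^ s"])
  qed
  also have "\<dots> = X ^ s * (\<Sum>k\<le>2*N. gauss_binom (X ^ A) (2*N) k * X ^ nat (theta_exp A B (int k - int N)))"
    by (simp only: sum_distrib_left)
  finally have 1: "(\<Prod>i<2*N. (X ^ A) ^ N + X ^ B * (X ^ A) ^ i) = \<dots>" .
  have 2: "(\<Prod>i<2*N. (X ^ A) ^ N + X ^ B * (X ^ A) ^ i) = X ^ s * 
     ((\<Prod>i<N. 1 + X ^ (A * i + B)) * (\<Prod>i<N. 1 + X ^ (A * i + (A - B))))"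
  proof -
    define h where "h i = (X ^ A) ^ N + X ^ B * (X ^ A) ^ i" for i
    have "(\<Prod>i<n + m. h i) = (\<Prod>i<n. h i) * (\<Prod>i<m. h (n + i))" for n m
      by (induction m) (simp_all add: ac_simps)
    hence "(\<Prod>i<2*N. h i) = (\<Prod>i<N. h i) * (\<Prod>i<N. h (N + i))"
      unfolding mult_2 by blast
    moreover have "h (N + i) = X ^ (A * N) * (1 + X ^ (A * i + B))" for i
      by (simp add: h_def algebra_simps power_add power_mult)
    moreover have "(\<Prod>i<N. h i) = (\<Prod>i<N. X ^ (A * i + B) * (1 + X ^ (A * (N - Suc i) + (A - B))))"
    proof (rule prod.cong[OF refl])
      fix i assume "i \<in> {..<N}"
      hence "N = Suc i + (N - Suc i)" by simp
      hence "A * N = A * (Suc i + (N - Suc i))" by (rule arg_cong)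
      hence "A * N = A * i + B + (A * (N - Suc i) + (A - B))"
        using assms by (simp add: algebra_simps)
      hence "X ^ (A * N) = X ^ (A * i + B) * X ^ (A * (N - Suc i) + (A - B))"
        by (simp only: power_add)
      thus "h i = X ^ (A * i + B) * (1 + X ^ (A * (N - Suc i) + (A - B)))"
        unfolding h_def distrib_left by (simp add: power_mult power_add ac_simps)
    qed
    moreover have "(\<Prod>i<N. X ^ (A * i + B)) = X ^ (A * t N + B * N)"
    proof (induction N)
      case (Suc n)
      have "t (Suc n) = t n + n" unfolding t_def by (rule tri_Suc)
      thus ?case using Suc by (simp add: algebra_simps power_add)
    qed (simp add: t_def)
    moreover have "(\<Prod>i<N. 1 + X ^ (A * (N - Suc i) + (A - B))) = (\<Prod>i<N. 1 + X ^ (A * i + (A - B)))"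
      by (rule prod.nat_diff_reindex)
    moreover have "X ^ s = X ^ (A * t N + B * N) * (X ^ (A * N)) ^ N"
      by (simp add: s_def power_add power_mult ac_simps flip: power_mult)
    ultimately show ?thesis
      unfolding h_def[symmetric] by (simp only: prod.distrib prod_constant card_lessThan ac_simps)
  qed
  have "X ^ s \<noteq> 0" by (simp add: X_def)
  with 1 2 show ?thesis unfolding X_def by simp
qed

text \<open>In degree \<open>m\<close> only the \<open>k\<close> with \<open>|k - N| \<le> m\<close>
  contribute. For these, multiplication by \<open>xprod A A\<close> turns the Gaussian binomial into
  1 up to terms of degree above \<open>m\<close>.\<close>

lemma tendsto_theta:
  assumes "0 < B" "B < A"
  shows "(\<lambda>N. (\<Sum>k\<le>2*N. gauss_binom (fps_X ^ A) (2 * N) k * fps_X ^ nat (theta_exp A B (int k - int N))) * xprod A A)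
     \<longlonglongrightarrow> theta A B"
proof (rule tendsto_fpsI)
  fix m
  \<comment> \<open>The bound on \<open>N\<close> keeps every \<open>k\<close> within
    \<open>m\<close> of \<open>N\<close> at distance more than \<open>m\<close> from both
    \<open>0\<close> and \<open>2 * N\<close>.\<close>
  have "fps_nth ((\<Sum>k\<le>2*N. gauss_binom (fps_X ^ A) (2 * N) k * fps_X ^ nat (theta_exp A B (int k - int N))) * xprod A A) m
     = fps_nth (theta A B) m" if N: "N \<ge> 2 * m + 1" for N
  proof -
    define e where "e k = theta_exp A B (int k - int N)" for k
    have e: "\<bar>int k - int N\<bar> \<le> e k" for k unfolding e_def by (rule theta_exp_ge[OF assms])
    have "fps_nth ((\<Sum>k\<le>2*N. gauss_binom (fps_X ^ A) (2 * N) k * fps_X ^ nat (e k)) * xprod A A) m = 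
      (\<Sum>k\<le>2*N. fps_nth (fps_X ^ nat (e k) * (gauss_binom (fps_X ^ A) (2 * N) k * xprod A A)) m)"
      by (simp only: sum_distrib_right sum_distrib_left fps_sum_nth ac_simps)
    also have "\<dots> = (\<Sum>k\<le>2*N. of_bool (e k = int m))"
    proof (rule sum.cong[OF refl])
      fix k assume "k \<in> {..2*N}"
      show "fps_nth (fps_X ^ nat (e k) * (gauss_binom (fps_X ^ A) (2 * N) k * xprod A A)) m = of_bool (e k = int m)"
      proof (cases "nat (e k) \<le> m")
        case True
        hence "\<bar>int k - int N\<bar> \<le> int m" using e[of k] by linarith
        hence "Suc m \<le> k" "k + Suc m \<le> 2 * N" using N by linarith+
        with assms have "fps_nth (gauss_binom (fps_X ^ A) (2 * N) k * xprod A A) (m - nat (e k)) = fps_nth 1 (m - nat (e k))"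
          by (intro gauss_binom_nth[where M = "Suc m"]) auto
        moreover have "m - nat (e k) = 0 \<longleftrightarrow> e k = int m" using True e[of k] by linarith
        ultimately show ?thesis using True unfolding fps_X_power_mult_nth by (auto simp del: diff_is_0_eq)
      next
        case False
        thus ?thesis by (auto simp: fps_X_power_mult_nth)
      qed
    qed
    also have "\<dots> = of_nat (card {k\<in>{..2*N}. e k = int m})"
      by (simp add: sum.If_cases of_bool_def Int_def)
    also have "card {k\<in>{..2*N}. e k = int m} = card {n. theta_exp A B n = int m}"
    proof (rule bij_betw_same_card)
      show "bij_betw (\<lambda>k. int k - int N) {k\<in>{..2*N}. e k = int m} {n. theta_exp A B n = int m}"
      proof (rule bij_betwI[where g = "\<lambda>n. nat (n + int N)"])
        show "(\<lambda>n. nat (n + int N)) \<in> {n. theta_exp A B n = int m} \<rightarrow> {k\<in>{..2*N}. e k = int m}"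
        proof
          fix n assume n: "n \<in> {n. theta_exp A B n = int m}"
          hence "\<bar>n\<bar> \<le> int m" using theta_exp_ge[OF assms, of n] by simp
          thus "nat (n + int N) \<in> {k\<in>{..2*N}. e k = int m}"
            using n N by (auto simp: e_def)
        qed
      next
        fix n assume n: "n \<in> {n. theta_exp A B n = int m}"
        hence "\<bar>n\<bar> \<le> int m" using theta_exp_ge[OF assms, of n] by simp
        thus "int (nat (n + int N)) - int N = n" using N by auto
      qed (auto simp: e_def)
    qed
    finally show ?thesis by (simp add: theta_nth e_def)
  qed
  thus "\<forall>\<^sub>F N in sequentially. fps_nth ((\<Sum>k\<le>2*N. gauss_binom (fps_X ^ A) (2 * N) k * 
      fps_X ^ nat (theta_exp A B (int k - int N))) * xprod A A) m = fps_nth (theta A B) m"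
    by (rule eventually_mono[OF eventually_ge_at_top[of "2 * m + 1"]])
qed

text \<open>Multiply the finite identity by \<open>xprod A A\<close>, let \<open>N\<close> tend to
  infinity and compare limits.\<close>

theorem jacobi_triple_product_mod2:
  assumes "0 < B" "B < A"
  shows "theta A B = xprod A B * xprod A (A - B) * xprod A A"
proof (rule LIMSEQ_unique[OF tendsto_theta[OF assms]])
  show "(\<lambda>N. (\<Sum>k\<le>2*N. gauss_binom (fps_X ^ A) (2 * N) k * fps_X ^ nat (theta_exp A B (int k - int N))) * xprod A A)
     \<longlonglongrightarrow> xprod A B * xprod A (A - B) * xprod A A"
    unfolding finite_jacobi[OF assms, symmetric]
    using assms by (intro tendsto_mult_fps xprod_LIMSEQ tendsto_const) auto
qed

section \<open>The series of even-indexed coefficients\<close>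

abbreviation euler :: "nat \<Rightarrow> bit fps" where
  "euler k \<equiv> xprod k k"

lemma euler_power2: "k > 0 \<Longrightarrow> (euler k)\<^sup>2 = euler (2 * k)"
  by (rule xprod_power2)

text \<open>Euler's identity for odd and distinct parts, read modulo 2: \<open>f_k\<close> is the
  product over the odd multiples of \<open>k\<close> times \<open>f_(2k) = f_k^2\<close>, and one
  \<open>f_k\<close> cancels.\<close>

lemma xprod_odd_mult_euler:
  assumes "k > 0"
  shows "xprod (2 * k) k * euler k = 1"
proof -
  have "euler k = xprod (2 * k) k * euler (2 * k)"
    using xprod_split[of k k 2] assms by (simp add: numeral_2_eq_2)
  also have "euler (2 * k) = euler k * euler k"
    using euler_power2[OF assms] by (simp add: power2_eq_square)
  finally have "euler k = euler k * (xprod (2 * k) k * euler k)"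
    by (simp only: ac_simps)
  thus ?thesis by (metis mult_cancel_left1 xprod_nonzero)
qed

text \<open>The pentagonal number theorem: the residues \<open>k\<close>, \<open>2k\<close>,
  \<open>3k\<close> modulo \<open>3k\<close> exhaust the multiples of \<open>k\<close>.\<close>

lemma theta_3k_k:
  assumes "k > 0"
  shows "theta (3 * k) k = euler k"
proof -
  have "euler k = xprod (3 * k) k * xprod (3 * k) (2 * k) * euler (3 * k)"
    using xprod_split[of k k 3] assms by (simp add: numeral_3_eq_3 numeral_2_eq_2 ac_simps)
  moreover have "3 * k - k = 2 * k" by simp
  ultimately show ?thesis
    using assms by (simp add: jacobi_triple_product_mod2)
qed

text \<open>The exponents are \<open>k n (2n - 1)\<close>. The residues \<open>k\<close> and
  \<open>3k\<close> modulo \<open>4k\<close> give all odd multiples of \<open>k\<close>, whose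
  product is \<open>1 / f_k\<close>; moreover \<open>f_(4k) = f_k^4\<close>.\<close>

lemma theta_4k_k:
  assumes "k > 0"
  shows "theta (4 * k) k = euler k ^ 3" "theta (4 * k) k * euler k = euler (4 * k)"
proof -
  have 4: "euler (4 * k) = euler k ^ 3 * euler k"
    using euler_power2[of k, symmetric] euler_power2[of "2 * k", symmetric] assms
    by (simp add: flip: power_mult power_Suc2)
  have "xprod (2 * k) k = xprod (4 * k) k * xprod (4 * k) (3 * k)"
  proof -
    have e: "2 * (2 * k) = 4 * k" "2 * k * 0 + k = k" "2 * k * 1 + k = 3 * k"
      by simp_all
    have "(\<Prod>j<2. f j) = f 0 * f 1" for f :: "nat \<Rightarrow> bit fps"
      by (simp add: numeral_2_eq_2)
    hence "xprod (2 * k) k = xprod (2 * (2 * k)) (2 * k * 0 + k) * xprod (2 * (2 * k)) (2 * k * 1 + k)"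
      using xprod_split[of "2 * k" k 2] assms by simp
    thus ?thesis unfolding e .
  qed
  moreover have "4 * k - k = 3 * k" by simp
  ultimately have "theta (4 * k) k = xprod (2 * k) k * euler (4 * k)"
    using assms by (simp add: jacobi_triple_product_mod2)
  also have "\<dots> = euler k ^ 3 * (xprod (2 * k) k * euler k)"
    unfolding 4 by (simp only: ac_simps)
  finally show "theta (4 * k) k = euler k ^ 3"
    by (simp add: xprod_odd_mult_euler assms)
  thus "theta (4 * k) k * euler k = euler (4 * k)" by (simp add: 4)
qed

text \<open>The exponents are \<open>k n (3n + 2)\<close>. The residues \<open>k\<close> and
  \<open>5k\<close> modulo \<open>6k\<close> give the odd multiples of \<open>k\<close> that are not
  multiples of \<open>3k\<close>, and the products over odd multiples are reciprocals of
  \<open>f_k\<close> and \<open>f_(3k)\<close>.\<close>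

lemma theta_6k_5k:
  assumes "k > 0"
  shows "theta (6 * k) (5 * k) * euler k = euler (3 * k) ^ 3"
proof -
  have "xprod (2 * k) k = xprod (6 * k) k * xprod (2 * (3 * k)) (3 * k) * xprod (6 * k) (5 * k)"
  proof -
    have e: "3 * (2 * k) = 6 * k" "2 * (3 * k) = 6 * k" "2 * k * 0 + k = k" "2 * k * 1 + k = 3 * k" "2 * k * 2 + k = 5 * k"
      by simp_all
    have "(\<Prod>j<3. f j) = f 0 * f 1 * f 2" for f :: "nat \<Rightarrow> bit fps"
      by (simp add: numeral_3_eq_3 numeral_2_eq_2)
    hence "xprod (2 * k) k = xprod (3 * (2 * k)) (2 * k * 0 + k) * xprod (3 * (2 * k)) (2 * k * 1 + k) * 
        xprod (3 * (2 * k)) (2 * k * 2 + k)"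
      using xprod_split[of "2 * k" k 3] assms by simp
    thus ?thesis unfolding e .
  qed
  moreover have "6 * k - 5 * k = k" by simp
  moreover have "euler (6 * k) = euler (3 * k) * euler (3 * k)"
    using euler_power2[of "3 * k"] assms by (simp add: power2_eq_square)
  ultimately have "theta (6 * k) (5 * k) * euler k * (xprod (2 * (3 * k)) (3 * k) * euler (3 * k)) = 
     (xprod (2 * k) k * euler k) * euler (3 * k) ^ 3"
    using assms by (simp add: jacobi_triple_product_mod2 power3_eq_cube ac_simps)
  moreover have "xprod (2 * (3 * k)) (3 * k) * euler (3 * k) = 1" "xprod (2 * k) k * euler k = 1"
    using xprod_odd_mult_euler[of "3 * k"] xprod_odd_mult_euler[of k] assms by auto
  ultimately show ?thesis by (simp only: mult_1_left mult_1_right)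
qed

text \<open>Among the exponents \<open>n (2n - 1)\<close>, those with \<open>n\<close> not congruent
  to 1 modulo 3 are the exponents of \<open>f_3\<close>, while \<open>n = 1 - 3k\<close> gives
  \<open>1 + 9k (2k - 1)\<close>.\<close>

lemma theta_4_1_split: "theta 4 1 = theta 9 3 + fps_X * theta 36 9"
proof (rule fps_ext)
  fix m
  let ?e = theta_exp
  have fin: "finite {n. ?e A B n = int m}" if "0 < B" "B < A" for A B
    by (rule finite_subset[of _ "{-int m..int m}"]) (auto simp: abs_le_iff dest!: theta_exp_ge[OF that, THEN order.trans, OF eq_refl])
  have val: "?e A B n = int m \<longleftrightarrow> int A * n * (n - 1) + 2 * int B * n = 2 * int m" for A B n
    using theta_exp_eq[of A B n] by linarith
  have three_mod_2E: "\<exists>i. n = 3 * i - 1" if "n mod 3 = 2" for n :: int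
    using that by presburger
  let ?S = "{n. ?e 4 1 n = int m}"
  have "?S = {n \<in> ?S. n mod 3 \<noteq> 1} \<union> {n \<in> ?S. n mod 3 = 1}" by auto
  hence "card ?S = card {n \<in> ?S. n mod 3 \<noteq> 1} + card {n \<in> ?S. n mod 3 = 1}"
    using fin[of 1 4] by (metis (no_types, lifting) card_Un_disjoint disjoint_iff finite_Un mem_Collect_eq one_less_numeral_iff semiring_norm(76) zero_less_one)
  moreover have "card {n. ?e 9 3 n = int m} = card {n \<in> ?S. n mod 3 \<noteq> 1}"
  proof (rule bij_betw_same_card)
    \<comment> \<open>Completing squares, \<open>n (2n - 1) = 3j (3j - 1) / 2\<close> means that
      \<open>4n - 1\<close> is \<open>6j - 1\<close> or its negative. Integrality of
      \<open>n\<close> forces the first case for even \<open>j\<close> and the second for odd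
      \<open>j\<close>.\<close>
    define f where "f j = (if even j then 3 * (j div 2) else - 3 * (j div 2) - 1)" for j :: int
    define g where "g n = (if n mod 3 = 0 then 2 * (n div 3) else 1 - 2 * ((n + 1) div 3))" for n :: int
    show "bij_betw f {n. ?e 9 3 n = int m} {n \<in> ?S. n mod 3 \<noteq> 1}"
    proof (rule bij_betwI[where g = g])
      show "f \<in> {n. ?e 9 3 n = int m} \<rightarrow> {n \<in> ?S. n mod 3 \<noteq> 1}"
      proof
        fix j assume "j \<in> {n. ?e 9 3 n = int m}"
        hence *: "9 * j * (j - 1) + 6 * j = 2 * int m" by (simp add: val)
        show "f j \<in> {n \<in> ?S. n mod 3 \<noteq> 1}"
        proof (cases "even j")
          case True
          then obtain i where "j = 2 * i" by (elim evenE)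
          with * show ?thesis by (simp add: f_def val algebra_simps)
        next
          case False
          then obtain i where "j = 2 * i + 1" by (elim oddE)
          with * show ?thesis by (simp add: f_def val algebra_simps) presburger
        qed
      qed
    next
      show "g \<in> {n \<in> ?S. n mod 3 \<noteq> 1} \<rightarrow> {n. ?e 9 3 n = int m}"
      proof
        fix n assume n: "n \<in> {n \<in> ?S. n mod 3 \<noteq> 1}"
        hence *: "4 * n * (n - 1) + 2 * n = 2 * int m" by (simp add: val)
        have "n mod 3 = 0 \<or> n mod 3 = 2" using n by auto
        thus "g n \<in> {n. ?e 9 3 n = int m}"
        proof
          assume "n mod 3 = 0"
          then obtain i where "n = 3 * i" by auto
          with * show ?thesis by (simp add: g_def val algebra_simps)
        next
          assume "n mod 3 = 2"
          then obtain i where "n = 3 * i - 1" by (metis three_mod_2E)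
          hence i: "n = 3 * i - 1" "g n = 1 - 2 * i" using \<open>n mod 3 = 2\<close> by (auto simp: g_def)
          show ?thesis using * unfolding i(2) mem_Collect_eq val unfolding i(1) by (simp add: algebra_simps)
        qed
      qed
    next
      fix j show "g (f j) = j"
      proof (cases "even j")
        case False
        then obtain b where b: "j = 2 * b + 1" by (elim oddE)
        have "(- 3 * b - 1) mod 3 \<noteq> 0" by presburger
        thus ?thesis using b by (simp add: f_def g_def)
      qed (auto simp: f_def g_def)
    next
      fix n assume n: "n \<in> {n \<in> ?S. n mod 3 \<noteq> 1}"
      hence "n mod 3 = 0 \<or> n mod 3 = 2" by auto
      thus "f (g n) = n" 
      proof
        assume "n mod 3 = 0"
        then obtain i where "n = 3 * i" by auto
        thus ?thesis by (simp add: f_def g_def)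
      next
        assume "n mod 3 = 2"
        then obtain i where "n = 3 * i - 1" by (metis three_mod_2E)
        moreover have "(3 * i - 1) mod 3 \<noteq> 0" "- ((1 - 2 * i) div 2) = i" by presburger+
        ultimately show ?thesis by (simp add: f_def g_def)
      qed
    qed
  qed
  moreover have "of_nat (card {n \<in> ?S. n mod 3 = 1}) = fps_nth (fps_X * theta 36 9) m"
  proof -
    have shift: "?e 4 1 (1 - 3 * k) = ?e 36 9 k + 1" for k
      using theta_exp_eq[of 4 1 "1 - 3 * k"] theta_exp_eq[of 36 9 k] by (simp add: algebra_simps)
    have "card {k. ?e 36 9 k + 1 = int m} = card {n \<in> ?S. n mod 3 = 1}"
    proof (rule bij_betw_same_card)
      show "bij_betw (\<lambda>k. 1 - 3 * k) {k. ?e 36 9 k + 1 = int m} {n \<in> ?S. n mod 3 = 1}"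
      proof (rule bij_betwI[where g = "\<lambda>n. (1 - n) div 3"])
        show "(\<lambda>k. 1 - 3 * k) \<in> {k. ?e 36 9 k + 1 = int m} \<rightarrow> {n \<in> ?S. n mod 3 = 1}"
          by (auto simp: shift simp del: One_nat_def) presburger
      next
        show "(\<lambda>n. (1 - n) div 3) \<in> {n \<in> ?S. n mod 3 = 1} \<rightarrow> {k. ?e 36 9 k + 1 = int m}"
        proof
          fix n assume n: "n \<in> {n \<in> ?S. n mod 3 = 1}"
          hence "n = 1 - 3 * ((1 - n) div 3)" by auto presburger
          thus "(1 - n) div 3 \<in> {k. ?e 36 9 k + 1 = int m}"
            using n shift[of "(1 - n) div 3"] by auto
        qed
      next
        fix n assume "n \<in> {n \<in> ?S. n mod 3 = 1}"
        thus "1 - 3 * ((1 - n) div 3) = n" by auto presburger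
      qed auto
    qed
    moreover have "of_nat (card {k. ?e 36 9 k + 1 = int m}) = fps_nth (fps_X * theta 36 9) m"
    proof (cases m)
      case 0
      have "{k. ?e 36 9 k + 1 = int m} = {}"
        using theta_exp_ge[of 9 36] 0 by (auto simp: abs_le_iff) (smt (verit))
      thus ?thesis using 0 by simp
    next
      case (Suc i)
      thus ?thesis by (simp add: theta_nth add.commute)
    qed
    ultimately show ?thesis by simp
  qed
  ultimately show "fps_nth (theta 4 1) m = fps_nth (theta 9 3 + fps_X * theta 36 9) m"
    by (simp add: theta_nth)
qed

section \<open>Squares and even parts of series over the field with two elements\<close>

text \<open>The terms \<open>i\<close> and \<open>n - i\<close> of the convolution cancel in pairs.
  Only a middle term survives; it exists for even \<open>n\<close> and is its own square root in
  \<open>bit\<close>.\<close>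

lemma bit_fps_power2_nth:
  fixes f :: "bit fps"
  shows "fps_nth (f\<^sup>2) (2 * m) = fps_nth f m" "fps_nth (f\<^sup>2) (2 * m + 1) = 0"
proof -
  have self: "a + a = 0" for a :: bit by (cases a) auto
  let ?h = "\<lambda>n i. fps_nth f i * fps_nth f (n - i)"
  have refl: "(\<Sum>i\<in>{Suc m..n}. ?h n i) = (\<Sum>i<n-m. ?h n i)" if "m \<le> n" for n m
    by (rule sum.reindex_bij_witness[of _ "\<lambda>i. n - i" "\<lambda>i. n - i"]) (use that in auto)
  have split: "sum H {0..n} = sum H {..<j} + sum H {j..n}" if "j \<le> n" for H :: "nat \<Rightarrow> bit" and j n
  proof -
    have "{0..n} = {..<j} \<union> {j..n}" using that by auto
    thus ?thesis by (simp only:) (rule sum.union_disjoint; auto)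
  qed
  have "fps_nth (f\<^sup>2) (2 * m) = (\<Sum>i<m. ?h (2*m) i) + (\<Sum>i\<in>{m..2*m}. ?h (2*m) i)"
    unfolding power2_eq_square fps_mult_nth by (rule split) simp
  also have "\<dots> = (\<Sum>i<m. ?h (2*m) i) + ?h (2*m) m + (\<Sum>i<m. ?h (2*m) i)"
    using refl[of m "2*m"] by (subst sum.atLeast_Suc_atMost) (simp_all only: add.assoc, simp_all)
  also have "\<dots> = ?h (2*m) m + ((\<Sum>i<m. ?h (2*m) i) + (\<Sum>i<m. ?h (2*m) i))"
    by (simp only: ac_simps)
  also have "\<dots> = fps_nth f m"
    unfolding self by (cases "fps_nth f m") auto
  finally show "fps_nth (f\<^sup>2) (2 * m) = fps_nth f m" .
  have "fps_nth (f\<^sup>2) (2 * m + 1) = (\<Sum>i<Suc m. ?h (2*m+1) i) + (\<Sum>i\<in>{Suc m..2*m+1}. ?h (2*m+1) i)"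
    unfolding power2_eq_square fps_mult_nth by (rule split) simp
  also have "\<dots> = (\<Sum>i<Suc m. ?h (2*m+1) i) + (\<Sum>i<Suc m. ?h (2*m+1) i)"
  proof -
    have "m \<le> 2 * m + 1" "2 * m + 1 - m = Suc m" by auto
    thus ?thesis using refl[of m "2*m+1"] by (simp only:)
  qed
  finally show "fps_nth (f\<^sup>2) (2 * m + 1) = 0" by (simp only: self)
qed

text \<open>A square has even exponents only, so it passes through the extraction of even
  coefficients; halving its exponents turns \<open>f^2\<close> into \<open>f\<close>.\<close>

lemma even_part_mult_power2:
  fixes g f :: "bit fps"
  shows "Abs_fps (\<lambda>n. fps_nth g (2 * n)) * f = Abs_fps (\<lambda>n. fps_nth (g * f\<^sup>2) (2 * n))"
proof (rule fps_ext)
  fix n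
  let ?h = "\<lambda>j. fps_nth g j * fps_nth (f\<^sup>2) (2 * n - j)"
  have odd: "?h j = 0" if "odd j" "j \<le> 2 * n" for j
  proof -
    obtain i where i: "j = 2 * i + 1" using \<open>odd j\<close> by (elim oddE)
    hence "2 * n - j = 2 * (n - i - 1) + 1" using that by auto
    thus ?thesis using bit_fps_power2_nth(2)[of f "n - i - 1"] by simp
  qed
  have "fps_nth (g * f\<^sup>2) (2 * n) = (\<Sum>j=0..2*n. ?h j)"
    by (simp add: fps_mult_nth)
  also have "\<dots> = (\<Sum>j\<in>(\<lambda>i. 2 * i) ` {0..n}. ?h j)"
  proof (rule sum.mono_neutral_right)
    show "\<forall>j\<in>{0..2*n} - (\<lambda>i. 2 * i) ` {0..n}. ?h j = 0"
    proof
      fix j assume j: "j \<in> {0..2*n} - (\<lambda>i. 2 * i) ` {0..n}"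
      have "odd j"
      proof
        assume "even j"
        then obtain i where "j = 2 * i" by (elim evenE)
        thus False using j by auto
      qed
      thus "?h j = 0" using j by (intro odd) auto
    qed
  qed auto
  also have "\<dots> = (\<Sum>i=0..n. ?h (2 * i))"
    by (subst sum.reindex) (auto simp: inj_on_def)
  also have "\<dots> = (\<Sum>i=0..n. fps_nth g (2 * i) * fps_nth f (n - i))"
    by (intro sum.cong) (auto simp: bit_fps_power2_nth(1) simp flip: diff_mult_distrib2)
  finally show "fps_nth (Abs_fps (\<lambda>n. fps_nth g (2 * n)) * f) n = fps_nth (Abs_fps (\<lambda>n. fps_nth (g * f\<^sup>2) (2 * n))) n"
    by (simp add: fps_mult_nth)
qed

text \<open>The exponent \<open>n (3n + 2)\<close> is even only for \<open>n = 2k\<close>, and half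
  of it is then \<open>2k (3k + 1)\<close>.\<close>

lemma even_part_theta_6_5: "Abs_fps (\<lambda>n. fps_nth (theta 6 5) (2 * n)) = theta 12 8"
proof (rule fps_ext)
  fix m
  have val: "theta_exp A B n = int m \<longleftrightarrow> int A * n * (n - 1) + 2 * int B * n = 2 * int m" for A B n m
    using theta_exp_eq[of A B n] by linarith
  have "card {n. theta_exp 12 8 n = int m} = card {n. theta_exp 6 5 n = int (2 * m)}"
  proof (rule bij_betw_same_card)
    show "bij_betw (\<lambda>k. 2 * k) {n. theta_exp 12 8 n = int m} {n. theta_exp 6 5 n = int (2 * m)}"
    proof (rule bij_betwI[where g = "\<lambda>n. n div 2"])
      have ev: "even n" if "n \<in> {n. theta_exp 6 5 n = int (2 * m)}" for n
      proof -
        have "6 * n * (n - 1) + 10 * n = 4 * int m" using that unfolding mem_Collect_eq val by simp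
        hence "2 * (3 * (n * n) + 2 * n) = 2 * (2 * int m)" by (simp add: algebra_simps)
        hence "3 * (n * n) + 2 * n = 2 * int m" by simp
        hence "even (3 * (n * n) + 2 * n)" by simp
        thus ?thesis by simp
      qed
      show "(\<lambda>n. n div 2) \<in> {n. theta_exp 6 5 n = int (2 * m)} \<rightarrow> {n. theta_exp 12 8 n = int m}"
      proof
        fix n assume n: "n \<in> {n. theta_exp 6 5 n = int (2 * m)}"
        obtain k where "n = 2 * k" using ev[OF n] by (elim evenE)
        thus "n div 2 \<in> {n. theta_exp 12 8 n = int m}"
          using n unfolding mem_Collect_eq val by (simp add: algebra_simps)
      qed
      show "2 * (n div 2) = n" if "n \<in> {n. theta_exp 6 5 n = int (2 * m)}" for n
        using ev[OF that] by simp
    qed (unfold val, auto simp: algebra_simps)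
  qed
  thus "fps_nth (Abs_fps (\<lambda>n. fps_nth (theta 6 5) (2 * n))) m = fps_nth (theta 12 8) m"
    by (simp add: theta_nth)
qed

section \<open>Reduction of the generating function modulo 2\<close>

text \<open>The partial products of \<open>gf3\<close> with the division in each factor carried out.
  Being available over every commutative ring, they connect \<open>rat\<close> with
  \<open>bit\<close> by way of \<open>int\<close>.\<close>

definition b3_prod :: "nat \<Rightarrow> 'a::comm_ring_1 fps" where
  "b3_prod N = (\<Prod>i\<le>N. 1 + fps_X ^ Suc i * (1 + fps_X ^ Suc i))"

lemma b3_prod_0: "b3_prod 0 = 1 + fps_X ^ 1 + fps_X ^ 2"
  by (simp add: b3_prod_def distrib_left power2_eq_square)

lemma b3_prod_Suc:
  "b3_prod (Suc N) = b3_prod N + fps_X ^ Suc (Suc N) * b3_prod N + fps_X ^ (2 * Suc (Suc N)) * (b3_prod N :: 'a::comm_ring_1 fps)"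
proof -
  have "b3_prod (Suc N) = b3_prod N * (1 + fps_X ^ Suc (Suc N) * (1 + fps_X ^ Suc (Suc N)) :: 'a fps)"
    by (simp add: b3_prod_def)
  also have "fps_X ^ (2 * Suc (Suc N)) = (fps_X ^ Suc (Suc N) * fps_X ^ Suc (Suc N) :: 'a fps)"
    by (simp only: mult_2 power_add)
  ultimately show ?thesis by (simp only: distrib_left mult_1_left mult_1_right ac_simps)
qed

lemma b3_prod_nth: "fps_nth (b3_prod N :: 'a::comm_ring_1 fps) m = of_int (fps_nth (b3_prod N) m)"
proof (induction N arbitrary: m)
  case 0
  show ?case by (simp only: b3_prod_0 fps_add_nth fps_one_nth fps_X_power_nth of_int_add) auto
next
  case (Suc N)
  thus ?case by (simp only: b3_prod_Suc fps_add_nth fps_X_power_mult_nth of_int_add) auto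
qed

text \<open>Factor by factor, \<open>(1 + y + y^2) (1 + y) = 1 + y^3\<close> modulo 2.\<close>

lemma gf3_mod2_mult_euler: "Abs_fps (\<lambda>m. of_int (b3 (int m)) :: bit) * euler 1 = euler 3"
proof (rule LIMSEQ_unique)
  have "(\<lambda>N. b3_prod N) \<longlonglongrightarrow> gf3"
    using has_prod_imp_tendsto[OF has_prod_gf3] unfolding gf3_factor b3_prod_def .
  \<comment> \<open>Each rational coefficient eventually equals its limit. Both are images of
    integers, so the equation holds in \<open>int\<close> and can be reduced modulo 2.\<close>
  hence ev: "\<forall>\<^sub>F N in sequentially. fps_nth (b3_prod N) m = b3 (int m)" for m
    unfolding tendsto_fps_iff fps_nth_gf3 b3_prod_nth[where 'a=rat] by simp
  have "(\<lambda>N. b3_prod N) \<longlonglongrightarrow> Abs_fps (\<lambda>m. of_int (b3 (int m)) :: bit)"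
  proof (rule tendsto_fpsI)
    fix m
    show "\<forall>\<^sub>F N in sequentially. fps_nth (b3_prod N) m = fps_nth (Abs_fps (\<lambda>m. of_int (b3 (int m)) :: bit)) m"
      using ev[of m] by eventually_elim (simp add: b3_prod_nth[where 'a=bit])
  qed
  moreover have "(\<lambda>N. \<Prod>i\<le>N. 1 + fps_X ^ (1 * i + 1)) \<longlonglongrightarrow> euler 1"
    using LIMSEQ_Suc[OF xprod_LIMSEQ[of 1 1]] by (simp add: lessThan_Suc_atMost)
  ultimately show "(\<lambda>N. b3_prod N * (\<Prod>i\<le>N. 1 + fps_X ^ (1 * i + 1))) \<longlonglongrightarrow> 
      Abs_fps (\<lambda>m. of_int (b3 (int m)) :: bit) * euler 1"
    by (rule tendsto_mult_fps)
  have "(1 + y * (1 + y)) * (1 + y) = 1 + y ^ 3" for y :: "bit fps"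
  proof -
    have "(1 + y * (1 + y)) * (1 + y) = 1 + y ^ 3 + (y + y) + (y * y + y * y)"
      by (simp only: power3_eq_cube distrib_left distrib_right mult_1_left mult_1_right ac_simps)
    thus ?thesis by (simp only: bit_fps_add_self add_0_right)
  qed
  hence "b3_prod N * (\<Prod>i\<le>N. 1 + fps_X ^ (1 * i + 1)) = (\<Prod>i\<le>N. 1 + (fps_X ^ Suc i) ^ 3 :: bit fps)" for N
    unfolding b3_prod_def prod.distrib[symmetric] by simp
  moreover have "(fps_X ^ Suc i) ^ 3 = (fps_X ^ (3 * i + 3) :: bit fps)" for i
    by (simp add: ac_simps flip: power_mult power_Suc)
  moreover have "(\<lambda>N. \<Prod>i\<le>N. 1 + fps_X ^ (3 * i + 3)) \<longlonglongrightarrow> euler 3"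
    using LIMSEQ_Suc[OF xprod_LIMSEQ[of 3 3]] by (simp add: lessThan_Suc_atMost)
  ultimately show "(\<lambda>N. b3_prod N * (\<Prod>i\<le>N. 1 + fps_X ^ (1 * i + 1)) :: bit fps) \<longlonglongrightarrow> euler 3"
    by (simp only:)
qed

text \<open>Multiplying by \<open>f_3^2\<close> is harmless for even parts because it is a square,
  and it turns \<open>f_3 / f_1\<close> into a theta series whose even part is known. The factor
  \<open>f_3\<close> left over is found again in \<open>theta 4 1\<close> and cancels.\<close>

lemma b3_even_mod2:
  "Abs_fps (\<lambda>m. of_int (b3 (2 * int m)) :: bit) = theta 3 1 * (1 + fps_X * theta 18 15)"
proof -
  define G where "G = Abs_fps (\<lambda>m. of_int (b3 (int m)) :: bit)"
  define S where "S = Abs_fps (\<lambda>m. of_int (b3 (2 * int m)) :: bit)"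
  have "G * (euler 3)\<^sup>2 * euler 1 = (G * euler 1) * (euler 3)\<^sup>2" by (simp only: ac_simps)
  also have "G * euler 1 = euler 3" unfolding G_def by (rule gf3_mod2_mult_euler)
  also have "euler 3 * (euler 3)\<^sup>2 = theta 6 5 * euler 1"
    using theta_6k_5k[of 1] by (simp add: power3_eq_cube power2_eq_square ac_simps)
  finally have "G * (euler 3)\<^sup>2 = theta 6 5" by simp
  moreover have "S = Abs_fps (\<lambda>n. fps_nth G (2 * n))" by (simp add: S_def G_def)
  ultimately have "S * euler 3 = theta 12 8"
    using even_part_mult_power2[of G "euler 3"] by (simp add: even_part_theta_6_5)
  \<comment> \<open>The triple product is symmetric in \<open>B\<close> and
    \<open>A - B\<close>.\<close>
  also have "\<dots> = theta 12 4" by (simp add: jacobi_triple_product_mod2 ac_simps)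
  also have "\<dots> = theta 4 1 * euler 1"
    using theta_3k_k[of 4] theta_4k_k(2)[of 1] by simp
  \<comment> \<open>The second summand \<open>q f_9^3\<close> also contains \<open>f_3\<close>, by
    \<open>theta_6k_5k\<close> with \<open>k = 3\<close>.\<close>
  also have "theta 4 1 = euler 3 + fps_X * (theta 18 15 * euler 3)"
    using theta_4_1_split theta_3k_k[of 3] theta_4k_k(1)[of 9] theta_6k_5k[of 3] by simp
  also have "\<dots> * euler 1 = theta 3 1 * (1 + fps_X * theta 18 15) * euler 3"
    using theta_3k_k[of 1] by (simp add: distrib_left distrib_right ac_simps)
  finally show ?thesis by (simp add: S_def)
qed

text \<open>A nonzero coefficient of the product needs a nonzero contribution from each factor.
  Completing the square turns a pentagonal exponent \<open>j\<close> into
  \<open>24 j + 1 = (6n - 1)^2\<close>; the exponents of the other factor are \<open>0\<close> and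
  \<open>(3k + 1)^2\<close>.\<close>

lemma odd_b3_imp_quadratic_form:
  assumes "odd (b3 (2 * int N))"
  shows "\<exists>u v::int. 24 * int N + 1 = u\<^sup>2 + 24 * v\<^sup>2"
proof -
  have th: "\<exists>n. int A * n * (n - 1) + 2 * int B * n = 2 * int m" if "fps_nth (theta A B) m \<noteq> 0" for A B m
  proof (rule ccontr)
    assume "\<not> ?thesis"
    hence "{n. int A * n * (n - 1) + 2 * int B * n = 2 * int m} = {}" by blast
    thus False using that by (simp add: theta_def)
  qed
  have "(of_int (b3 (2 * int N)) :: bit) \<noteq> 0"
    using assms by (auto elim!: oddE)
  hence "fps_nth (theta 3 1 * (1 + fps_X * theta 18 15)) N \<noteq> 0"
    unfolding b3_even_mod2[symmetric] by simp
  then obtain j where j: "j \<le> N" "fps_nth (theta 3 1) j * fps_nth (1 + fps_X * theta 18 15) (N - j) \<noteq> 0"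
    unfolding fps_mult_nth by (metis (no_types, lifting) atLeastAtMost_iff sum.neutral)
  define i where "i = N - j"
  from j have nz: "fps_nth (theta 3 1) j \<noteq> 0" "fps_nth (1 + fps_X * theta 18 15) i \<noteq> 0"
    unfolding i_def mult_eq_0_iff by blast+
  obtain n where "int 3 * n * (n - 1) + 2 * int 1 * n = 2 * int j" using th[OF nz(1)] by blast
  hence n: "24 * int j + 1 = (6 * n - 1)\<^sup>2" by (simp add: power2_eq_square algebra_simps)
  obtain v where v: "int i = v\<^sup>2"
  proof (cases i)
    case 0
    thus ?thesis using that[of 0] by simp
  next
    case (Suc l)
    hence "fps_nth (theta 18 15) l \<noteq> 0" using nz(2) by simp
    then obtain k where "int 18 * k * (k - 1) + 2 * int 15 * k = 2 * int l" using th by blast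
    hence "int i = (3 * k + 1)\<^sup>2" using Suc by (simp add: power2_eq_square algebra_simps)
    thus ?thesis by (rule that)
  qed
  have "24 * int N + 1 = (24 * int j + 1) + 24 * int i" using j(1) by (simp add: i_def)
  thus ?thesis unfolding n v by blast
qed

section \<open>Primes for which -6 is a non-residue\<close>

lemma square_mod_24: "(z::int)\<^sup>2 mod 24 \<in> {0, 1, 4, 9, 12, 16}"
proof -
  have "z mod 24 \<in> {0..<24}" by simp
  also have "{0..<24::int} = set [0..23]" by auto
  also have "[0..23::int] = [0,1,2,3,4,5,6,7,8,9,10,11,12,13,14,15,16,17,18,19,20,21,22,23]"
    by (simp add: upto.simps)
  finally have "((z mod 24)\<^sup>2) mod 24 \<in> {0, 1, 4, 9, 12, 16}"
    unfolding list.set by (elim insertE) simp_all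
  thus ?thesis by (simp add: power_mod)
qed

text \<open>These are the two reduced forms of discriminant -24.\<close>

lemma form_mod_24:
  "((x::int)\<^sup>2 + 6 * y\<^sup>2) mod 24 \<notin> {13, 17, 19, 23}"
  "(2 * (x::int)\<^sup>2 + 3 * y\<^sup>2) mod 24 \<notin> {13, 17, 19, 23}"
proof -
  have eq: "(x\<^sup>2 + 6 * y\<^sup>2) mod 24 = (x\<^sup>2 mod 24 + 6 * (y\<^sup>2 mod 24)) mod 24"
    "(2 * x\<^sup>2 + 3 * y\<^sup>2) mod 24 = (2 * (x\<^sup>2 mod 24) + 3 * (y\<^sup>2 mod 24)) mod 24"
    by (intro mod_add_cong mod_mult_cong refl; simp)+
  have "(a + 6 * b) mod 24 \<notin> {13, 17, 19, 23} \<and> (2 * a + 3 * b) mod 24 \<notin> {13, 17, 19, 23}"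
    if "a \<in> {0, 1, 4, 9, 12, 16}" "b \<in> {0, 1, 4, 9, 12, 16}" for a b :: int
    using that by (elim insertE emptyE; hypsubst; simp)
  from this[OF square_mod_24[of x] square_mod_24[of y]]
  show "(x\<^sup>2 + 6 * y\<^sup>2) mod 24 \<notin> {13, 17, 19, 23}" "(2 * x\<^sup>2 + 3 * y\<^sup>2) mod 24 \<notin> {13, 17, 19, 23}"
    unfolding eq by blast+
qed

text \<open>A root \<open>r\<close> of -6 modulo \<open>p\<close> would give, by the pigeonhole
  principle, small \<open>x\<close> and \<open>y\<close>, not both zero, with \<open>x\<close>
  congruent to \<open>r y\<close>. Then \<open>x^2 + 6 y^2 = k p\<close> with
  \<open>1 \<le> k \<le> 6\<close>, and every such \<open>k\<close> contradicts
  \<open>form_mod_24\<close>.\<close>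

lemma minus_6_nonresidue:
  fixes p :: nat and r :: int
  assumes p: "prime p" "p mod 24 \<in> {13, 17, 19, 23}"
  shows "\<not> int p dvd r\<^sup>2 + 6"
proof
  assume r: "int p dvd r\<^sup>2 + 6"
  define s where "s = nat (floor (sqrt (real p)))"
  have s: "s\<^sup>2 < p" "p < (s + 1)\<^sup>2"
  proof -
    have "real s \<le> sqrt (real p)" "sqrt (real p) < real s + 1"
      using of_nat_floor[of "sqrt (real p)"] real_sqrt_ge_zero[of "real p"] unfolding s_def by linarith+
    hence "(real s)\<^sup>2 \<le> (sqrt (real p))\<^sup>2" "(sqrt (real p))\<^sup>2 < (real s + 1)\<^sup>2"
      by (intro power_mono power_strict_mono; simp)+
    hence "real (s\<^sup>2) \<le> real p" "real p < real ((s + 1)\<^sup>2)" by (simp_all add: algebra_simps)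
    hence "s\<^sup>2 \<le> p" "p < (s + 1)\<^sup>2" by (simp_all only: of_nat_le_iff of_nat_less_iff)
    \<comment> \<open>A prime is not a square; the strict inequality is what yields
      \<open>x^2 + 6 y^2 < 7 p\<close>.\<close>
    moreover have "s\<^sup>2 \<noteq> p" using p(1) by (auto simp: prime_power_iff)
    ultimately show "s\<^sup>2 < p" "p < (s + 1)\<^sup>2" by auto
  qed
  let ?I = "{0..int s}"
  let ?f = "\<lambda>(a, b). (a - r * b) mod int p"
  \<comment> \<open>There are \<open>(s + 1)^2 > p\<close> pairs but only \<open>p\<close>
    residues.\<close>
  have "\<not> inj_on ?f (?I \<times> ?I)"
  proof
    assume "inj_on ?f (?I \<times> ?I)"
    hence "card (?I \<times> ?I) = card (?f ` (?I \<times> ?I))" by (simp add: card_image)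
    also have "\<dots> \<le> card {0..<int p}"
      using prime_gt_0_nat[OF p(1)] by (intro card_mono) auto
    finally have "(s + 1)\<^sup>2 \<le> p" by (simp add: power2_eq_square card_cartesian_product nat_add_distrib)
    thus False using s by simp
  qed
  then obtain z z' where z: "z \<in> ?I \<times> ?I" "z' \<in> ?I \<times> ?I" "?f z = ?f z'" "z \<noteq> z'"
    unfolding inj_on_def by blast
  obtain a b a' b' where "z = (a, b)" "z' = (a', b')" by (meson surj_pair)
  with z have ab: "a \<in> ?I" "b \<in> ?I" "a' \<in> ?I" "b' \<in> ?I" "(a, b) \<noteq> (a', b')"
      "(a - r * b) mod int p = (a' - r * b') mod int p"
    by simp_all
  define x where "x = a - a'"
  define y where "y = b - b'"
  have "int p dvd x - r * y"
    using ab(6) unfolding mod_eq_dvd_iff by (simp add: x_def y_def algebra_simps)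
  hence "int p dvd (x - r * y) * (x + r * y) + y\<^sup>2 * (r\<^sup>2 + 6)"
    by (intro dvd_add[OF dvd_mult2 dvd_mult[OF r]])
  also have "\<dots> = x\<^sup>2 + 6 * y\<^sup>2" by (simp add: power2_eq_square algebra_simps)
  finally obtain k where k: "x\<^sup>2 + 6 * y\<^sup>2 = int p * k" by (elim dvdE)
  have "\<bar>x\<bar> \<le> int s" "\<bar>y\<bar> \<le> int s" using ab by (auto simp: x_def y_def)
  hence "x\<^sup>2 \<le> (int s)\<^sup>2" "y\<^sup>2 \<le> (int s)\<^sup>2" by (auto simp flip: abs_le_square_iff)
  moreover have "(int s)\<^sup>2 < int p" using s(1) by (metis of_nat_less_iff of_nat_power)
  ultimately have "int p * k < int p * 7" unfolding k[symmetric] by linarith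
  hence "k < 7" using p(1) by (simp add: prime_gt_0_nat)
  moreover have "x\<^sup>2 + 6 * y\<^sup>2 > 0"
  proof -
    have "x \<noteq> 0 \<or> y \<noteq> 0" using ab by (auto simp: x_def y_def)
    thus ?thesis by (auto intro: add_pos_nonneg add_nonneg_pos)
  qed
  hence "k > 0" using k p(1) by (metis of_nat_0_less_iff prime_gt_0_nat zero_less_mult_pos)
  ultimately have k7: "k \<in> {1,2,3,4,5,6}" by auto
  have three: "prime (3::int)" by simp
  have np: "int p mod 24 \<in> {13, 17, 19, 23}"
  proof -
    have "int p mod 24 = int (p mod 24)" by (simp add: zmod_int)
    thus ?thesis using p(2) by (elim insertE emptyE) simp_all
  qed
  have no: "u\<^sup>2 + 6 * v\<^sup>2 \<noteq> int p" "2 * u\<^sup>2 + 3 * v\<^sup>2 \<noteq> int p" for u v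
    using form_mod_24[of u v] np by auto
  \<comment> \<open>For \<open>k \<noteq> 5\<close>, common factors 2 and 3 can be removed until
    \<open>p\<close> itself is a value of one of the two forms. For \<open>k = 5\<close>,
    multiplication by 5 permutes the four residue classes, so \<open>5 p\<close> is excluded modulo
    24.\<close>
  from k7 show False
  proof (elim insertE emptyE)
    assume "k = 1"
    thus False using k no(1)[of x y] by simp
  next
    assume "k = 5"
    hence "(x\<^sup>2 + 6 * y\<^sup>2) mod 24 = (int p mod 24 * 5) mod 24" using k by (simp add: mod_simps)
    thus False using form_mod_24(1)[of x y] np by auto
  next
    assume "k = 2"
    hence "x\<^sup>2 = 2 * (int p - 3 * y\<^sup>2)" using k by simp
    hence "even (x\<^sup>2)" by simp
    then obtain u where "x = 2 * u" by (auto elim: evenE)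
    thus False using k no(2)[of u y] \<open>k = 2\<close> by simp
  next
    assume "k = 4"
    hence "x\<^sup>2 = 2 * (2 * int p - 3 * y\<^sup>2)" using k by simp
    hence "even (x\<^sup>2)" by simp
    then obtain u where u: "x = 2 * u" by (auto elim: evenE)
    hence "3 * y\<^sup>2 = 2 * (int p - u\<^sup>2)" using k \<open>k = 4\<close> by simp
    hence "even (3 * y\<^sup>2)" by simp
    then obtain v where "y = 2 * v" by (auto elim: evenE)
    thus False using k no(1)[of u v] \<open>k = 4\<close> u by simp
  next
    assume "k = 3"
    hence "x\<^sup>2 = 3 * (int p - 2 * y\<^sup>2)" using k by simp
    hence "3 dvd x\<^sup>2" by simp
    then obtain u where "x = 3 * u" by (metis three prime_dvd_power dvdE)
    thus False using k no(2)[of y u] \<open>k = 3\<close> by simp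
  next
    assume "k = 6"
    hence *: "x\<^sup>2 = 6 * (int p - y\<^sup>2)" using k by simp
    hence "3 dvd x\<^sup>2" "even (x\<^sup>2)" by simp_all
    hence "3 dvd x" "2 dvd x" by (metis three prime_dvd_power, simp)
    hence "6 dvd x" by presburger
    then obtain u where "x = 6 * u" by (elim dvdE)
    thus False using k no(1)[of y u] \<open>k = 6\<close> by simp
  qed
qed

text \<open>If \<open>p\<close> did not divide \<open>v\<close>, then \<open>u / (2v)\<close> would
  be a square root of -6 modulo \<open>p\<close>. So \<open>p\<close> divides \<open>v\<close>,
  hence also \<open>u\<close>.\<close>

lemma inert_dvd_form_imp_power2_dvd:
  fixes p :: nat and u v :: int
  assumes p: "prime p" "p mod 24 \<in> {13, 17, 19, 23}" and dvd: "int p dvd u\<^sup>2 + 24 * v\<^sup>2"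
  shows "(int p)\<^sup>2 dvd u\<^sup>2 + 24 * v\<^sup>2"
proof -
  have ip: "prime (int p)" using p by simp
  have v: "int p dvd v"
  proof (rule ccontr)
    assume "\<not> int p dvd v"
    moreover have "\<not> int p dvd 2"
    proof
      assume "int p dvd 2"
      hence "int p \<le> 2" by (rule zdvd_imp_le) simp
      hence "p \<le> 2" by simp
      hence "p mod 24 = p" by simp
      thus False using p(2) \<open>p \<le> 2\<close> by auto
    qed
    ultimately have "\<not> int p dvd 2 * v" using ip prime_dvd_mult_iff by blast
    hence "coprime (2 * v) (int p)"
      using ip by (metis prime_imp_coprime coprime_commute)
    then obtain w where "[2 * v * w = 1] (mod int p)" by (metis cong_solve_coprime_int)
    hence w: "int p dvd 2 * v * w - 1" by (simp add: cong_iff_dvd_diff)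
    have "(u * w)\<^sup>2 + 6 = w\<^sup>2 * (u\<^sup>2 + 24 * v\<^sup>2) - 6 * ((2 * v * w - 1) * (2 * v * w + 1))"
      by (simp add: power2_eq_square algebra_simps)
    hence "int p dvd (u * w)\<^sup>2 + 6" using dvd w by (simp add: dvd_mult dvd_mult2)
    thus False using minus_6_nonresidue[OF p] by blast
  qed
  hence "int p dvd 24 * v\<^sup>2" by (simp add: power2_eq_square)
  hence "int p dvd u\<^sup>2" using dvd by (metis dvd_add_left_iff)
  hence "int p dvd u" using ip prime_dvd_power by blast
  thus ?thesis using v by (intro dvd_add dvd_mult dvd_power_same)
qed

section \<open>The reciprocals of the inert primes\<close>

text \<open>Each \<open>a (Suc k)\<close> is absorbed by \<open>b k\<close>, so the sum is at most
  \<open>a 0 - a K\<close>.\<close>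

lemma sum_minus_shift_le:
  fixes a b :: "nat \<Rightarrow> real"
  assumes "\<And>k. a (Suc k) \<le> b k" "\<And>k. 0 \<le> a k"
  shows "(\<Sum>k<K. a k - b k) \<le> a 0"
proof -
  have "(\<Sum>k<K. a k - b k) \<le> a 0 - a K"
  proof (induction K)
    case (Suc K)
    thus ?case using assms(1)[of K] by simp
  qed simp
  thus ?thesis using assms(2)[of K] by simp
qed

section \<open>The quadratic character of discriminant -24 and its L-series\<close>

text \<open>The Kronecker symbol of discriminant -24; the primes with value -1 are the inert
  ones.\<close>

definition chi24 :: "nat \<Rightarrow> real" where
  "chi24 n = (if n mod 24 \<in> {1, 5, 7, 11} then 1 else if n mod 24 \<in> {13, 17, 19, 23} then - 1 else 0)"

lemma mod_24_cases:
  "n mod 24 \<in> {0,1,2,3,4,5,6,7,8,9,10,11,12,13,14,15,16,17,18,19,20,21,22,23::nat}"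
proof -
  have "n mod 24 \<in> set [0..<24]" by simp
  also have "[0..<24] = [0,1,2,3,4,5,6,7,8,9,10,11,12,13,14,15,16,17,18,19,20,21,22,23]"
    by (simp add: upt_conv_Cons)
  finally show ?thesis unfolding list.set .
qed

lemma chi24_mult: "chi24 (m * n) = chi24 m * chi24 n"
proof -
  txt \<open>\<open>f\<close> and \<open>g\<close> are the Legendre--Jacobi symbols \<open>(2/n)\<close> and \<open>(n/3)\<close>.\<close>
  define f :: "nat \<Rightarrow> real" where "f n = (if n \<in> {1, 7} then 1 else if n \<in> {3, 5} then - 1 else 0)" for n
  define g :: "nat \<Rightarrow> real" where "g n = (if n = 1 then 1 else if n = 2 then - 1 else 0)" for n
  have chi: "chi24 n = f (n mod 8) * g (n mod 3)" for n
  proof -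
    note mod_24_cases[of n]
    moreover have "n mod 8 = (n mod 24) mod 8" "n mod 3 = (n mod 24) mod 3"
      by (simp_all add: mod_mod_cancel)
    ultimately show ?thesis
      by (elim insertE emptyE) (simp_all add: chi24_def f_def g_def)
  qed
  \<comment> \<open>The factorization of the character leaves 64 and 9 pairs of residues to check,
    in place of 576 modulo 24.\<close>
  have "f (i * j mod 8) = f i * f j" if "i < 8" "j < 8" for i j
  proof -
    have "i \<in> {0,1,2,3,4,5,6,7}" "j \<in> {0,1,2,3,4,5,6,7}" using that by auto
    thus ?thesis by (elim insertE emptyE) (simp_all add: f_def)
  qed
  from this[of "m mod 8" "n mod 8"] have "f (m * n mod 8) = f (m mod 8) * f (n mod 8)"
    by (simp add: mod_mult_eq)
  moreover have "g (i * j mod 3) = g i * g j" if "i < 3" "j < 3" for i j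
  proof -
    have "i \<in> {0,1,2}" "j \<in> {0,1,2}" using that by auto
    thus ?thesis by (elim insertE emptyE) (simp_all add: g_def)
  qed
  from this[of "m mod 3" "n mod 3"] have "g (m * n mod 3) = g (m mod 3) * g (n mod 3)"
    by (simp add: mod_mult_eq)
  ultimately show ?thesis by (simp add: chi)
qed

lemma abs_chi24_le: "\<bar>chi24 n\<bar> \<le> 1"
  by (simp add: chi24_def)

lemma summable_powr:
  assumes "s > 1"
  shows "(\<lambda>n::nat. real n powr - s) summable_on UNIV"
  using assms by (subst summable_on_UNIV_nonneg_real_iff) (auto simp: summable_real_powr_iff)

lemma summable_bounded_powr:
  assumes "s > 1" "\<And>n. \<bar>f n\<bar> \<le> 1"
  shows "(\<lambda>n::nat. f n * real n powr - s) summable_on A"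
proof (rule summable_on_subset[OF _ subset_UNIV])
  have "(\<lambda>n. norm (f n * real n powr - s)) summable_on UNIV"
  proof (rule summable_on_comparison_test)
    show "(\<lambda>n::nat. real n powr - s) summable_on UNIV"
      by (rule summable_powr[OF assms(1)])
    show "norm (f n * real n powr - s) \<le> real n powr - s" for n
      using assms(2)[of n] mult_right_mono[of "\<bar>f n\<bar>" 1 "real n powr - s"] by (simp add: abs_mult)
  qed simp
  thus "(\<lambda>n::nat. f n * real n powr - s) summable_on UNIV"
    by (rule abs_summable_summable)
qed

text \<open>
  The negative terms at \<open>24k + 13, \<dots>, 24k + 23\<close> outweigh the positive ones at
  \<open>24(k+1) + 1, \<dots>, 24(k+1) + 11\<close>, so only the first four positive terms remain.
\<close>

lemma L_chi24_le:
  assumes "s > 1"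
  shows "(\<Sum>\<^sub>\<infinity>n. chi24 n * real n powr - s) \<le> 4"
proof -
  let ?t = "\<lambda>n::nat. chi24 n * real n powr - s"
  define a where "a k = (\<Sum>j\<in>{1, 5, 7, 11}. real (24 * k + j) powr - s)" for k :: nat
  define b where "b k = (\<Sum>j\<in>{13, 17, 19, 23}. real (24 * k + j) powr - s)" for k :: nat
  have summ: "?t summable_on UNIV"
    using assms by (rule summable_bounded_powr) (rule abs_chi24_le)
  hence "?t sums (\<Sum>\<^sub>\<infinity>n. ?t n)"
    by (intro has_sum_imp_sums has_sum_infsum)
  hence "(\<lambda>N. \<Sum>n<N. ?t n) \<longlonglongrightarrow> (\<Sum>\<^sub>\<infinity>n. ?t n)" by (simp add: sums_def)
  \<comment> \<open>Only partial sums over whole periods of the character are considered.\<close>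
  moreover have "strict_mono (\<lambda>K::nat. K * 24)" by (simp add: strict_mono_def)
  ultimately have lim: "(\<lambda>K. \<Sum>n<K*24. ?t n) \<longlonglongrightarrow> (\<Sum>\<^sub>\<infinity>n. ?t n)"
    using LIMSEQ_subseq_LIMSEQ by (fastforce simp: o_def)
  have block: "(\<Sum>n<K*24. ?t n) = (\<Sum>k<K. a k - b k)" for K
  proof -
    have "(\<Sum>n<K*24. ?t n) = (\<Sum>k<K. \<Sum>n\<in>{k*24..<k*24+24}. ?t n)"
      by (simp add: sum.nat_group)
    also have "\<dots> = (\<Sum>k<K. a k - b k)"
    proof (rule sum.cong[OF refl])
      fix k
      have "(\<Sum>n\<in>{k*24..<k*24+24}. ?t n) = (\<Sum>j\<in>{0..<24}. ?t (24 * k + j))"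
        by (rule sum.reindex_bij_witness[of _ "\<lambda>j. 24 * k + j" "\<lambda>n. n - 24 * k"]) auto
      also have "\<dots> = (\<Sum>j\<in>{0..<24}. chi24 j * real (24 * k + j) powr - s)"
        by (intro sum.cong refl arg_cong2[where f = "(*)"]) (simp add: chi24_def)
      also have "\<dots> = (\<Sum>j\<in>{0..<24}. (if j \<in> {1, 5, 7, 11} then real (24 * k + j) powr - s else 0) - 
          (if j \<in> {13, 17, 19, 23} then real (24 * k + j) powr - s else 0))"
        by (intro sum.cong) (simp_all add: chi24_def)
      also have "\<dots> = a k - b k"
      proof -
        have "{0..<24} \<inter> {1, 5, 7, 11::nat} = {1, 5, 7, 11}" "{0..<24} \<inter> {13, 17, 19, 23::nat} = {13, 17, 19, 23}"
          by auto
        thus ?thesis unfolding sum_subtractf a_def b_def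
          by (simp only: sum.inter_restrict[symmetric] finite_atLeastLessThan)
      qed
      finally show "(\<Sum>n\<in>{k*24..<k*24+24}. ?t n) = a k - b k" .
    qed
    finally show ?thesis .
  qed
  have "(\<Sum>k<K. a k - b k) \<le> a 0" for K
  proof (rule sum_minus_shift_le)
    fix k
    have "real (24 * Suc k + i) powr - s \<le> real (24 * k + j) powr - s" if "j \<le> 24 + i" "j > 0" for i j
      using that assms by (intro powr_mono2') auto
    from this[of 13 1] this[of 17 5] this[of 19 7] this[of 23 11] show "a (Suc k) \<le> b k"
      unfolding a_def b_def by simp
    show "0 \<le> a k" unfolding a_def by (intro sum_nonneg) auto
  qed
  moreover have "a 0 \<le> 4"
  proof -
    have "real j powr - s \<le> 1" if "j \<ge> 1" for j :: nat
      using that assms powr_mono2'[of "-s" 1 "real j"] by simp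
    from this[of 5] this[of 7] this[of 11] show ?thesis by (simp add: a_def)
  qed
  ultimately have "(\<Sum>n<K*24. ?t n) \<le> 4" for K unfolding block by (metis order.trans)
  thus ?thesis by (intro LIMSEQ_le_const2[OF lim]) auto
qed

section \<open>Comparison of the zeta series with the L-series\<close>

text \<open>A further prime \<open>p\<close> removes the multiples \<open>p A\<close> from the set
  \<open>A\<close> sieved so far. By complete multiplicativity the sum over \<open>p A\<close> is
  \<open>f p * real p powr - s\<close> times the sum over \<open>A\<close>, which yields one Euler
  factor.\<close>

lemma infsum_sieve:
  fixes f :: "nat \<Rightarrow> real"
  assumes "s > 1" "finite S" "\<And>p. p \<in> S \<Longrightarrow> prime p"
    and mult: "\<And>m n. f (m * n) = f m * f n" and le: "\<And>n. \<bar>f n\<bar> \<le> 1"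
  shows "(\<Sum>\<^sub>\<infinity>n. f n * real n powr - s) * (\<Prod>p\<in>S. 1 - f p * real p powr - s) = 
     (\<Sum>\<^sub>\<infinity>n | \<forall>p\<in>S. \<not> p dvd n. f n * real n powr - s)"
  using assms(2,3)
proof (induction S rule: finite_induct)
  case (insert p S)
  let ?t = "\<lambda>n::nat. f n * real n powr - s"
  define A where "A = {n::nat. \<forall>q\<in>S. \<not> q dvd n}"
  have p: "prime p" using insert by simp
  have AB: "A = {n. \<forall>q\<in>insert p S. \<not> q dvd n} \<union> (*) p ` A"
  proof -
    have "q dvd p * n \<longleftrightarrow> q dvd n" if "q \<in> S" for q n
    proof -
      have "prime q" "q \<noteq> p" using insert that by auto
      thus ?thesis using p prime_dvd_mult_iff primes_dvd_imp_eq by blast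
    qed
    hence "p * n \<in> A \<longleftrightarrow> n \<in> A" for n unfolding A_def by blast
    note pA = this
    show ?thesis
    proof (intro equalityI subsetI)
      fix x assume x: "x \<in> A"
      show "x \<in> {n. \<forall>q\<in>insert p S. \<not> q dvd n} \<union> (*) p ` A"
      proof (cases "p dvd x")
        case True
        then obtain n where "x = p * n" by (elim dvdE)
        thus ?thesis using x pA by blast
      next
        case False
        thus ?thesis using x unfolding A_def by blast
      qed
    next
      fix x assume "x \<in> {n. \<forall>q\<in>insert p S. \<not> q dvd n} \<union> (*) p ` A"
      thus "x \<in> A" using pA unfolding A_def by blast
    qed
  qed
  have summ: "?t summable_on B" for B
    using assms(1) le by (rule summable_bounded_powr)
  have "infsum ?t A = infsum ?t {n. \<forall>q\<in>insert p S. \<not> q dvd n} + infsum ?t ((*) p ` A)"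
    by (subst AB, rule infsum_Un_disjoint) (auto intro: summ)
  also have "infsum ?t ((*) p ` A) = infsum (?t \<circ> (*) p) A"
    using p by (intro infsum_reindex) (auto simp: inj_on_def)
  also have "?t \<circ> (*) p = (\<lambda>n. ?t p * ?t n)"
    by (rule ext) (simp only: o_apply mult of_nat_mult powr_mult of_nat_0_le_iff ac_simps)
  also have "infsum (\<lambda>n. ?t p * ?t n) A = ?t p * infsum ?t A"
    by (rule infsum_cmult_right') 
  finally have "infsum ?t {n. \<forall>q\<in>insert p S. \<not> q dvd n} = infsum ?t A * (1 - ?t p)"
    by (simp add: algebra_simps)
  moreover have "infsum ?t UNIV * (\<Prod>p\<in>S. 1 - ?t p) = infsum ?t A"
    using insert unfolding A_def by simp
  ultimately show ?case using insert.hyps by (simp add: ac_simps)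
qed simp

lemma chi24_eq_1:
  assumes "n > 0" "\<And>p. prime p \<Longrightarrow> p dvd n \<Longrightarrow> chi24 p = 1"
  shows "chi24 n = 1"
  using assms
proof (induction n rule: less_induct)
  case (less n)
  show ?case
  proof (cases "n = 1")
    case True
    thus ?thesis by (simp add: chi24_def)
  next
    case False
    then obtain p m where p: "prime p" "n = p * m" by (metis prime_factor_nat dvdE)
    have m: "m < n" "m > 0" using less.prems(1) p prime_gt_1_nat[OF p(1)] by (auto simp: p(2))
    have "chi24 q = 1" if "prime q" "q dvd m" for q
      using less.prems(2)[of q] that p(2) by simp
    with m have "chi24 m = 1" by (rule less.IH)
    moreover have "chi24 p = 1" using less.prems(2)[of p] p by simp
    ultimately show ?thesis by (simp add: p(2) chi24_mult)
  qed
qed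

text \<open>This follows from \<open>1 \<le> (1 - x) (1 + 2x)\<close> and
  \<open>1 + 2x \<le> exp (2x)\<close>. It serves to bound the Euler factors
  \<open>1 - 1 / p\<close> from below.\<close>

lemma exp_minus_double_le:
  fixes x :: real
  assumes "0 \<le> x" "x \<le> 1 / 2"
  shows "exp (- (2 * x)) \<le> 1 - x"
proof -
  have "1 \<le> (1 - x) * (1 + 2 * x)"
  proof -
    have "0 \<le> x * (1 - 2 * x)" using assms by (intro mult_nonneg_nonneg) auto
    thus ?thesis by (simp add: algebra_simps)
  qed
  also have "\<dots> \<le> (1 - x) * exp (2 * x)"
    using assms exp_ge_add_one_self[of "2 * x"] by (intro mult_left_mono) auto
  finally show ?thesis by (simp add: exp_minus field_simps)
qed

text \<open>A positive \<open>n\<close> in \<open>F\<close> that survives the sieve has only prime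
  factors with character value 1, so \<open>chi24 n = 1\<close>. Hence the two sieved series agree
  on \<open>F\<close>, and elsewhere their terms differ by at most twice
  \<open>real n powr - s\<close>.\<close>

lemma zeta_sieve_le:
  assumes s: "s > 1" and S: "finite S" "\<And>p. p \<in> S \<Longrightarrow> prime p"
    and F: "\<And>p. prime p \<Longrightarrow> p \<le> y \<Longrightarrow> chi24 p \<noteq> 1 \<Longrightarrow> p \<in> S" "F \<subseteq> {..y}"
  shows "(\<Sum>\<^sub>\<infinity>n. real n powr - s) * (\<Prod>p\<in>S. 1 - real p powr - s) \<le> 
     (\<Sum>\<^sub>\<infinity>n. chi24 n * real n powr - s) * (\<Prod>p\<in>S. 1 - chi24 p * real p powr - s) +
     2 * (\<Sum>\<^sub>\<infinity>n\<in>-F. real n powr - s)"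
proof -
  define A where "A = {n::nat. \<forall>p\<in>S. \<not> p dvd n}"
  have summ: "(\<lambda>n. real n powr - s) summable_on B" "(\<lambda>n. chi24 n * real n powr - s) summable_on B" for B
    using summable_bounded_powr[OF s, of "\<lambda>_. 1" B] summable_bounded_powr[OF s, of chi24 B] abs_chi24_le
    by simp_all
  have 1: "(\<Sum>\<^sub>\<infinity>n. real n powr - s) * (\<Prod>p\<in>S. 1 - real p powr - s) = (\<Sum>\<^sub>\<infinity>n\<in>A. real n powr - s)"
    using infsum_sieve[OF s S, of "\<lambda>_. 1"] by (simp add: A_def)
  have 2: "(\<Sum>\<^sub>\<infinity>n. chi24 n * real n powr - s) * (\<Prod>p\<in>S. 1 - chi24 p * real p powr - s) = 
      (\<Sum>\<^sub>\<infinity>n\<in>A. chi24 n * real n powr - s)"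
    using infsum_sieve[OF s S, of chi24] chi24_mult abs_chi24_le by (simp add: A_def)
  have "(\<Sum>\<^sub>\<infinity>n\<in>A. real n powr - s) - (\<Sum>\<^sub>\<infinity>n\<in>A. chi24 n * real n powr - s) = 
     (\<Sum>\<^sub>\<infinity>n\<in>A. real n powr - s - chi24 n * real n powr - s)"
    using infsum_add[OF summ(1)[of A] summable_on_uminus[THEN iffD2, OF summ(2)[of A]]]
    by (simp add: infsum_uminus)
  also have "\<dots> \<le> (\<Sum>\<^sub>\<infinity>n\<in>-F. 2 * real n powr - s)"
  proof (rule infsum_mono_neutral)
    show "(\<lambda>n. real n powr - s - chi24 n * real n powr - s) summable_on A"
      using summable_on_add[OF summ(1)[of A] summable_on_uminus[THEN iffD2, OF summ(2)[of A]]] by simp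
    show "(\<lambda>n. 2 * real n powr - s) summable_on -F"
      by (rule summable_on_cmult_right) (rule summ)
    show "real n powr - s - chi24 n * real n powr - s \<le> 2 * real n powr - s" for n
    proof -
      have "(- 1) * real n powr - s \<le> chi24 n * real n powr - s"
        using abs_chi24_le[of n] by (intro mult_right_mono) auto
      thus ?thesis by simp
    qed
    show "real n powr - s - chi24 n * real n powr - s \<le> 0" if n: "n \<in> A - (- F)" for n
    \<comment> \<open>The terms at \<open>n = 0\<close> vanish because
      \<open>0 powr - s = 0\<close>.\<close>
    proof (cases "n = 0")
      case False
      have "n \<le> y" using n F by auto
      have "chi24 n = 1"
      proof (rule chi24_eq_1)
        fix p assume p: "prime p" "p dvd n"
        hence "p \<le> y" using \<open>n \<le> y\<close> False by (meson dvd_imp_le le_trans neq0_conv)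
        thus "chi24 p = 1" using p n F(1)[of p] by (auto simp: A_def)
      qed (use False in auto)
      thus ?thesis by simp
    qed simp
  qed auto
  also have "\<dots> = 2 * (\<Sum>\<^sub>\<infinity>n\<in>-F. real n powr - s)"
    by (rule infsum_cmult_right')
  finally show ?thesis using 1 2 by simp
qed

text \<open>In the comparison of the two series, the L-series is at most 4, its Euler factors at
  most \<open>exp K\<close>, the tail at most 1, and the Euler factors of zeta at least
  \<open>exp (- (2 * (K + 1)))\<close>. The sets \<open>F\<close> and \<open>S\<close> depend on
  \<open>s\<close>, but the resulting bound does not.\<close>

lemma zeta_le:
  assumes s: "s > 1" and K: "\<And>S. finite S \<Longrightarrow> (\<And>p. p \<in> S \<Longrightarrow> prime p \<and> p mod 24 \<in> {13, 17, 19, 23}) \<Longrightarrow> 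
      (\<Sum>p\<in>S. 1 / real p) \<le> K"
  shows "(\<Sum>\<^sub>\<infinity>n. real n powr - s) \<le> (4 * exp K + 2) * exp (2 * (K + 1))"
proof -
  define Z where "Z = (\<Sum>\<^sub>\<infinity>n. real n powr - s)"
  have summ: "(\<lambda>n. real n powr - s) summable_on B" for B
    using summable_bounded_powr[OF s, of "\<lambda>_. 1" B] by simp
  have "((\<lambda>n. real n powr - s) has_sum Z) UNIV"
    unfolding Z_def by (rule has_sum_infsum) (rule summ)
  \<comment> \<open>A finite set \<open>F\<close> is chosen that carries the zeta series up to an
    error below 1.\<close>
  hence "\<forall>\<^sub>F F in finite_subsets_at_top UNIV. dist (\<Sum>n\<in>F. real n powr - s) Z < 1"
    unfolding has_sum_def by (rule tendstoD) simp
  then obtain F :: "nat set" where F: "finite F" "dist (\<Sum>n\<in>F. real n powr - s) Z < 1"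
    unfolding eventually_finite_subsets_at_top by blast
  have tail: "(\<Sum>\<^sub>\<infinity>n\<in>-F. real n powr - s) \<le> 1"
  proof -
    have "(\<Sum>\<^sub>\<infinity>n\<in>UNIV - F. real n powr - s) = Z - (\<Sum>n\<in>F. real n powr - s)"
      unfolding Z_def using F(1) by (subst infsum_Diff) (auto intro: summ)
    thus ?thesis using F(2) by (simp add: Compl_eq_Diff_UNIV dist_real_def)
  qed
  obtain y where y: "F \<subseteq> {..y}" using finite_nat_iff_bounded_le[of F] F(1) by auto
  define S where "S = {p. prime p \<and> p \<le> y \<and> chi24 p \<noteq> 1}"
  define I where "I = {p. prime p \<and> p \<le> y \<and> p mod 24 \<in> {13, 17, 19, 23}}"
  have fin: "finite S" "finite I"
    by (rule finite_subset[of _ "{..y}"]; auto simp: S_def I_def)+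
  \<comment> \<open>The only primes at which the character vanishes are 2 and 3.\<close>
  have S_le: "S \<subseteq> I \<union> {2, 3}"
  proof
    fix p assume p: "p \<in> S"
    have "p \<in> I \<or> p = 2 \<or> p = 3"
    proof (rule ccontr)
      assume *: "\<not> ?thesis"
      have pr: "prime p" and chi: "chi24 p = 0" 
        using p * by (auto simp: S_def I_def chi24_def split: if_splits)
      have "\<not> 2 dvd p" "\<not> 3 dvd p"
        using pr * primes_dvd_imp_eq[of 2 p] primes_dvd_imp_eq[of 3 p] by auto
      hence "p mod 24 \<in> {1, 5, 7, 11, 13, 17, 19, 23}"
      proof -
        have "\<not> 2 dvd p mod 24" "\<not> 3 dvd p mod 24"
          using \<open>\<not> 2 dvd p\<close> \<open>\<not> 3 dvd p\<close> by (simp_all add: dvd_mod_iff)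
        thus ?thesis using mod_24_cases[of p] by (elim insertE emptyE) simp_all
      qed
      thus False using chi by (auto simp: chi24_def split: if_splits)
    qed
    thus "p \<in> I \<union> {2, 3}" by auto
  qed
  have chi_S: "chi24 p = (if p \<in> I then - 1 else 0)" if "p \<in> S" for p
    using that S_le by (auto simp: I_def chi24_def)
  have powr_le: "real p powr - s \<le> 1 / real p" if "prime p" for p
  proof -
    have "real p powr - s \<le> real p powr - 1"
      using s prime_ge_1_nat[OF that] by (intro powr_mono) auto
    also have "real p powr - 1 = 1 / real p"
      using prime_gt_0_nat[OF that] by (simp add: powr_minus_divide)
    finally show ?thesis .
  qed
  have sumI: "(\<Sum>p\<in>I. 1 / real p) \<le> K"
    using fin by (intro K) (auto simp: I_def)
  \<comment> \<open>The additional 1 accounts for \<open>1/2 + 1/3\<close>.\<close>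
  have sumS: "(\<Sum>p\<in>S. 1 / real p) \<le> K + 1"
  proof -
    have "(\<Sum>p\<in>S. 1 / real p) \<le> (\<Sum>p\<in>I \<union> {2, 3}. 1 / real p)"
      using fin S_le by (intro sum_mono2) auto
    also have "\<dots> \<le> (\<Sum>p\<in>I. 1 / real p) + (\<Sum>p\<in>{2, 3::nat}. 1 / real p)"
      using fin by (subst sum_Un) (auto intro!: sum_nonneg)
    finally show ?thesis using sumI by simp
  qed
  have upper: "(\<Prod>p\<in>S. 1 - chi24 p * real p powr - s) \<le> exp K"
  proof -
    have "(\<Prod>p\<in>S. 1 - chi24 p * real p powr - s) \<le> (\<Prod>p\<in>S. exp (if p \<in> I then 1 / real p else 0))"
    proof (rule prod_mono, safe)
      fix p assume p: "p \<in> S"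
      hence pr: "prime p" by (simp add: S_def)
      have "- 1 \<le> real p powr - s" by (rule order.trans[OF _ powr_ge_zero]) simp
      thus "0 \<le> 1 - chi24 p * real p powr - s" using chi_S[OF p] by simp
      have "1 + real p powr - s \<le> exp (1 / real p)"
        using powr_le[OF pr] exp_ge_add_one_self[of "1 / real p"] by linarith
      thus "1 - chi24 p * real p powr - s \<le> exp (if p \<in> I then 1 / real p else 0)"
        using chi_S[OF p] by simp
    qed
    also have "\<dots> = exp (\<Sum>p\<in>S. if p \<in> I then 1 / real p else 0)"
      by (rule exp_sum[symmetric]) (rule fin)
    also have "(\<Sum>p\<in>S. if p \<in> I then 1 / real p else 0) \<le> (\<Sum>p\<in>I. 1 / real p)"
      using fin by (subst sum.inter_restrict[symmetric]) (auto intro!: sum_mono2)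
    also have "\<dots> \<le> K" by (rule sumI)
    finally show ?thesis by simp
  qed
  have lower: "exp (- (2 * (K + 1))) \<le> (\<Prod>p\<in>S. 1 - real p powr - s)"
  proof -
    have "exp (- (2 * (K + 1))) \<le> exp (\<Sum>p\<in>S. - (2 * (1 / real p)))"
    proof -
      have "(\<Sum>p\<in>S. - (2 * (1 / real p))) = - (2 * (\<Sum>p\<in>S. 1 / real p))"
        by (simp only: sum_negf sum_distrib_left)
      thus ?thesis using sumS by simp
    qed
    also have "\<dots> = (\<Prod>p\<in>S. exp (- (2 * (1 / real p))))" by (rule exp_sum) (rule fin)
    also have "\<dots> \<le> (\<Prod>p\<in>S. 1 - real p powr - s)"
    proof (rule prod_mono, safe)
      fix p assume "p \<in> S"
      hence pr: "prime p" by (simp add: S_def)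
      have "exp (- (2 * (1 / real p))) \<le> 1 - 1 / real p"
        using prime_ge_2_nat[OF pr] by (intro exp_minus_double_le) (auto simp: field_simps)
      also have "\<dots> \<le> 1 - real p powr - s" using powr_le[OF pr] by simp
      finally show "exp (- (2 * (1 / real p))) \<le> 1 - real p powr - s" .
    qed auto
    finally show ?thesis .
  qed
  have "Z \<ge> 0" unfolding Z_def by (rule infsum_nonneg) auto
  hence "Z * exp (- (2 * (K + 1))) \<le> Z * (\<Prod>p\<in>S. 1 - real p powr - s)"
    by (intro mult_left_mono lower)
  also have "\<dots> \<le> (\<Sum>\<^sub>\<infinity>n. chi24 n * real n powr - s) * (\<Prod>p\<in>S. 1 - chi24 p * real p powr - s) +
     2 * (\<Sum>\<^sub>\<infinity>n\<in>-F. real n powr - s)"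
    unfolding Z_def using fin y by (intro zeta_sieve_le s) (auto simp: S_def)
  also have "(\<Sum>\<^sub>\<infinity>n. chi24 n * real n powr - s) * (\<Prod>p\<in>S. 1 - chi24 p * real p powr - s) \<le> 
      4 * (\<Prod>p\<in>S. 1 - chi24 p * real p powr - s)"
    using s by (intro mult_right_mono L_chi24_le prod_nonneg) (auto simp: chi_S intro: order.trans[OF _ powr_ge_zero])
  also have "\<dots> \<le> 4 * exp K" using upper by simp
  also have "2 * (\<Sum>\<^sub>\<infinity>n\<in>-F. real n powr - s) \<le> 2" using tail by simp
  finally have "Z * exp (- (2 * (K + 1))) \<le> 4 * exp K + 2" by simp
  from mult_right_mono[OF this, of "exp (2 * (K + 1))"] show ?thesis
    unfolding Z_def[symmetric] mult.assoc exp_add[symmetric] by simp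
qed

text \<open>Otherwise the zeta series would be bounded uniformly in \<open>s > 1\<close>. Letting
  \<open>s\<close> tend to 1 in its finite partial sums would then bound the harmonic
  series.\<close>

lemma inert_reciprocals_unbounded:
  "\<exists>S. finite S \<and> (\<forall>p\<in>S. prime p \<and> p mod 24 \<in> {13, 17, 19, 23}) \<and> K < (\<Sum>p\<in>S. 1 / real p)"
proof (rule ccontr)
  assume "\<not> ?thesis"
  hence K: "(\<Sum>p\<in>S. 1 / real p) \<le> K" 
    if "finite S" "\<And>p. p \<in> S \<Longrightarrow> prime p \<and> p mod 24 \<in> {13, 17, 19, 23}" for S
    using that by (meson not_le)
  define C where "C = (4 * exp K + 2) * exp (2 * (K + 1))"
  have "(\<Sum>n<N. inverse (real n)) \<le> C" for N
  proof -
    have le: "(\<Sum>n<N. real n powr - s) \<le> C" if "s > 1" for s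
    proof -
      have "(\<Sum>n<N. real n powr - s) \<le> (\<Sum>\<^sub>\<infinity>n. real n powr - s)"
        using summable_bounded_powr[OF that, of "\<lambda>_. 1"] by (intro finite_sum_le_infsum) auto
      also have "\<dots> \<le> C" unfolding C_def using that K by (rule zeta_le)
      finally show ?thesis .
    qed
    have "((\<lambda>s. \<Sum>n<N. real n powr - s) \<longlongrightarrow> (\<Sum>n<N. real n powr - 1)) (at_right 1)"
    proof (intro tendsto_sum)
      fix n
      show "((\<lambda>s. real n powr - s) \<longlongrightarrow> real n powr - 1) (at_right 1)"
        using tendsto_powr[OF tendsto_const tendsto_minus[OF tendsto_ident_at], of "real n" 1 "{1<..}"]
        by (cases "n = 0") simp_all
    qed
    hence "(\<Sum>n<N. real n powr - 1) \<le> C"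
      by (rule tendsto_upperbound) (auto simp: eventually_at_right_less intro: eventually_mono[OF eventually_at_right_less] le)
    \<comment> \<open>At \<open>n = 0\<close> both sides are 0 by convention.\<close>
    moreover have "real n powr - 1 = inverse (real n)" for n
      by (cases "n = 0") (simp_all add: powr_minus)
    ultimately show ?thesis by simp
  qed
  hence "summable (\<lambda>n. inverse (real n))"
    by (intro summableI_nonneg_bounded) auto
  thus False using not_summable_harmonic[where 'a = real] by simp
qed

section \<open>Sieving by exact divisibility\<close>

lemma card_periodic:
  fixes P :: "nat \<Rightarrow> bool"
  assumes "\<And>n. P (n mod M) = P n"
  shows "card {n. n < k * M \<and> P n} = k * card {n. n < M \<and> P n}"
proof (induction k)
  case (Suc k)
  have P: "P (n + k * M) = P n" for n
    using assms[of "n + k * M"] assms[of n] by simp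
  have "{n. n < Suc k * M \<and> P n} = {n. n < k * M \<and> P n} \<union> (\<lambda>n. n + k * M) ` {n. n < M \<and> P n}"
  proof (intro equalityI subsetI)
    fix n assume n: "n \<in> {n. n < Suc k * M \<and> P n}"
    show "n \<in> {n. n < k * M \<and> P n} \<union> (\<lambda>n. n + k * M) ` {n. n < M \<and> P n}"
    proof (cases "n < k * M")
      case False
      then obtain m where "n = m + k * M" by (metis add.commute le_Suc_ex not_less)
      thus ?thesis using n P[of m] by auto
    qed (use n in auto)
  qed (auto simp: P)
  moreover have "card ((\<lambda>n. n + k * M) ` {n. n < M \<and> P n}) = card {n. n < M \<and> P n}"
    by (rule card_image) (simp add: inj_on_def)
  moreover have "card ({n. n < k * M \<and> P n} \<union> (\<lambda>n. n + k * M) ` {n. n < M \<and> P n}) =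
      card {n. n < k * M \<and> P n} + card ((\<lambda>n. n + k * M) ` {n. n < M \<and> P n})"
    by (rule card_Un_disjoint) auto
  ultimately show ?case using Suc by simp
qed simp

text \<open>By the Chinese remainder theorem the residues modulo \<open>a\<close> and
  \<open>b\<close> determine a number below \<open>a * b\<close>.\<close>

lemma card_periodic_coprime:
  fixes P Q :: "nat \<Rightarrow> bool"
  assumes "coprime a b" "a > 0" "b > 0" "\<And>n. P (n mod a) = P n" "\<And>n. Q (n mod b) = Q n"
  shows "card {n. n < a * b \<and> P n \<and> Q n} \<le> card {n. n < a \<and> P n} * card {n. n < b \<and> Q n}"
proof -
  let ?f = "\<lambda>n. (n mod a, n mod b)"
  have "inj_on ?f {n. n < a * b \<and> P n \<and> Q n}"
  proof (rule inj_onI)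
    fix m n assume mn: "m \<in> {n. n < a * b \<and> P n \<and> Q n}" "n \<in> {n. n < a * b \<and> P n \<and> Q n}" "?f m = ?f n"
    hence "[m = n] (mod (a * b))"
      using assms(1) by (intro coprime_cong_mult_nat) (auto simp: cong_def)
    thus "m = n" using mn by (simp add: cong_def)
  qed
  hence "card {n. n < a * b \<and> P n \<and> Q n} \<le> card ({n. n < a \<and> P n} \<times> {n. n < b \<and> Q n})"
    by (rule card_inj_on_le) (use assms in auto)
  thus ?thesis by (simp add: card_cartesian_product)
qed

section \<open>Density of the numbers that survive the sieve\<close>

text \<open>For inert primes this is the condition that the representation
  \<open>24 n + 1 = u^2 + 24 v^2\<close> imposes on \<open>n\<close>.\<close>

definition exact_free :: "nat set \<Rightarrow> nat \<Rightarrow> bool" where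
  "exact_free S n \<longleftrightarrow> (\<forall>p\<in>S. p dvd 24 * n + 1 \<longrightarrow> p\<^sup>2 dvd 24 * n + 1)"

lemma dvd_affine_mod:
  fixes d m n :: nat
  assumes "d dvd m"
  shows "d dvd 24 * (n mod m) + 1 \<longleftrightarrow> d dvd 24 * n + 1"
proof -
  have "24 * n + 1 = 24 * (n mod m) + 1 + 24 * (m * (n div m))"
    proof -
    have "24 * (n mod m + m * (n div m)) = 24 * n" by (simp only: mod_mult_div_eq)
    thus ?thesis unfolding distrib_left by linarith
  qed
  moreover have "d dvd 24 * (m * (n div m))" using assms by simp
  ultimately show ?thesis by (metis dvd_add_left_iff)
qed

lemma exact_free_mod:
  assumes "\<And>p. p \<in> S \<Longrightarrow> p\<^sup>2 dvd M"
  shows "exact_free S (n mod M) = exact_free S n"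
proof -
  have "p dvd M" if "p \<in> S" for p
    using assms[OF that] by (auto simp: power2_eq_square elim: dvd_mult_left)
  thus ?thesis unfolding exact_free_def using assms dvd_affine_mod by blast
qed

lemma prime_gt_3_not_dvd_24:
  fixes p :: nat
  assumes "prime p" "p > 3"
  shows "\<not> p dvd 24"
proof
  assume "p dvd 24"
  hence "p dvd 2 ^ 3 * 3" by simp
  hence "p dvd 2 \<or> p dvd 3" using assms(1) by (meson prime_dvd_mult_iff prime_dvd_power)
  thus False using assms(2) by (auto dest!: dvd_imp_le)
qed

text \<open>With \<open>24 c + 1\<close> divisible by \<open>p^2\<close>, the \<open>p - 1\<close>
  residues \<open>c + j p\<close>, \<open>1 \<le> j \<le> p - 1\<close>, make
  \<open>24 n + 1\<close> divisible by \<open>p\<close> exactly once and are lost modulo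
  \<open>p^2\<close>.\<close>

lemma card_exact_free_prime:
  assumes p: "prime p" "p > 3"
  shows "card {n. n < p\<^sup>2 \<and> exact_free {p} n} \<le> p\<^sup>2 - (p - 1)"
proof -
  have nd: "\<not> p dvd 24" by (rule prime_gt_3_not_dvd_24[OF p])
  hence "coprime 24 (p\<^sup>2)" using p(1) by (metis coprime_commute coprime_power_right_iff prime_imp_coprime)
  hence "coprime (24::int) (int (p\<^sup>2))" by (metis coprime_int_iff of_nat_numeral)
  then obtain w where "[24 * w = 1] (mod int (p\<^sup>2))" by (metis cong_solve_coprime_int)
  \<comment> \<open>This is the residue of \<open>- 1 / 24\<close> modulo
    \<open>p^2\<close>.\<close>
  define c where "c = nat ((- w) mod int (p\<^sup>2))"
  have "int c = (- w) mod int (p\<^sup>2)" using p by (simp add: c_def prime_gt_0_nat)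
  hence "[24 * int c + 1 = 24 * (- w) + 1] (mod int (p\<^sup>2))"
    by (intro cong_add cong_mult) (auto simp: cong_def)
  also have "[24 * (- w) + 1 = - 1 + 1] (mod int (p\<^sup>2))"
    using \<open>[24 * w = 1] (mod int (p\<^sup>2))\<close> by (intro cong_add) (auto simp: cong_minus_minus_iff)
  finally have "int (p\<^sup>2) dvd 24 * int c + 1" by (simp add: cong_0_iff)
  hence "int (p\<^sup>2) dvd int (24 * c + 1)" by (simp add: add.commute)
  hence c: "p\<^sup>2 dvd 24 * c + 1" by (simp only: int_dvd_int_iff)
  define g where "g j = (c + j * p) mod p\<^sup>2" for j
  have bad: "\<not> exact_free {p} (g j)" if "j \<in> {1..p-1}" for j
  proof -
    have e: "24 * (c + j * p) + 1 = (24 * c + 1) + 24 * j * p" by simp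
    have "p dvd 24 * c + 1" using c by (auto simp: power2_eq_square elim: dvd_mult_left)
    hence "p dvd 24 * (c + j * p) + 1" unfolding e by (rule dvd_add) simp
    hence "p dvd 24 * g j + 1" unfolding g_def by (subst dvd_affine_mod) auto
    moreover have "\<not> p\<^sup>2 dvd 24 * g j + 1"
    proof
      assume "p\<^sup>2 dvd 24 * g j + 1"
      hence "p\<^sup>2 dvd (24 * c + 1) + 24 * j * p" unfolding g_def e[symmetric] by (subst (asm) dvd_affine_mod) auto
      hence "p\<^sup>2 dvd 24 * j * p" using c by (metis dvd_add_right_iff)
      hence "p dvd 24 * j" using p by (simp add: power2_eq_square)
      hence "p dvd j" using nd p(1) prime_dvd_mult_iff by blast
      thus False using that by (auto dest!: dvd_imp_le)
    qed
    ultimately show ?thesis by (simp add: exact_free_def)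
  qed
  have "inj_on g {1..p-1}"
  proof (rule inj_onI)
    fix i j assume ij: "i \<in> {1..p-1}" "j \<in> {1..p-1}" "g i = g j"
    hence "[c + i * p = c + j * p] (mod p * p)" by (simp add: g_def cong_def power2_eq_square)
    hence "[i * p = j * p] (mod p * p)" by (simp add: cong_add_lcancel_nat)
    hence "[i = j] (mod p)" using p by (metis cong_mult_rcancel_nat cong_def mod_mult_mult2 mult_cancel_right not_prime_0)
    thus "i = j" using ij by (auto simp: cong_def)
  qed
  hence "p - 1 = card (g ` {1..p-1})" by (simp add: card_image)
  also have "\<dots> \<le> card {n. n < p\<^sup>2 \<and> \<not> exact_free {p} n}"
    using bad p by (intro card_mono) (auto simp: g_def prime_gt_0_nat)
  finally have "p - 1 \<le> card {n. n < p\<^sup>2 \<and> \<not> exact_free {p} n}" .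
  moreover have "card {n. n < p\<^sup>2 \<and> \<not> exact_free {p} n} + card {n. n < p\<^sup>2 \<and> exact_free {p} n} = card {..<p\<^sup>2}"
  proof -
    have "{n. n < p\<^sup>2 \<and> \<not> exact_free {p} n} \<union> {n. n < p\<^sup>2 \<and> exact_free {p} n} = {..<p\<^sup>2}" by auto
    thus ?thesis by (metis (no_types, lifting) card_Un_disjoint disjoint_iff finite_Un finite_lessThan mem_Collect_eq)
  qed
  ultimately show ?thesis by simp
qed

lemma card_exact_free:
  assumes "finite S" "\<And>p. p \<in> S \<Longrightarrow> prime p \<and> p > 3"
  shows "card {n. n < (\<Prod>p\<in>S. p\<^sup>2) \<and> exact_free S n} \<le> (\<Prod>p\<in>S. p\<^sup>2 - (p - 1))"
  using assms
proof (induction S rule: finite_induct)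
  case empty
  show ?case by (simp add: exact_free_def)
next
  case (insert p S)
  define M where "M = (\<Prod>p\<in>S. p\<^sup>2)"
  have "coprime (p\<^sup>2) M"
    unfolding M_def using insert by (intro prod_coprime_right) (auto intro!: primes_coprime)
  moreover have "M > 0" unfolding M_def using insert by (intro prod_pos) (auto simp: prime_gt_0_nat)
  moreover have "p\<^sup>2 > 0" using insert by (auto simp: prime_gt_0_nat)
  moreover have "exact_free S (n mod M) = exact_free S n" for n
    using insert unfolding M_def by (intro exact_free_mod dvd_prodI)
  moreover have "exact_free {p} (n mod p\<^sup>2) = exact_free {p} n" for n
    by (intro exact_free_mod) auto
  ultimately have "card {n. n < p\<^sup>2 * M \<and> exact_free {p} n \<and> exact_free S n} \<le> 
      card {n. n < p\<^sup>2 \<and> exact_free {p} n} * card {n. n < M \<and> exact_free S n}"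
    by (intro card_periodic_coprime)
  also have "\<dots> \<le> (p\<^sup>2 - (p - 1)) * (\<Prod>p\<in>S. p\<^sup>2 - (p - 1))"
    using insert unfolding M_def by (intro mult_le_mono card_exact_free_prime) auto
  finally show ?case using insert by (simp add: exact_free_def M_def)
qed

text \<open>The condition is periodic with period \<open>M\<close>, the product of the
  \<open>p^2\<close>. The product of the local proportions bounds the proportion of survivors per
  period, and one incomplete period costs at most \<open>M\<close>.\<close>

lemma exact_free_density:
  assumes "finite S" "\<And>p. p \<in> S \<Longrightarrow> prime p \<and> p > 3" "x > 0"
  shows "real (card {n. real n \<le> x \<and> exact_free S n}) \<le>
     x * (\<Prod>p\<in>S. 1 - (real p - 1) / (real p)\<^sup>2) + (\<Prod>p\<in>S. (real p)\<^sup>2)"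
proof -
  define M where "M = (\<Prod>p\<in>S. p\<^sup>2)"
  define c where "c = card {n. n < M \<and> exact_free S n}"
  have M: "M > 0" unfolding M_def using assms by (intro prod_pos) (auto simp: prime_gt_0_nat)
  \<comment> \<open>Enough full periods to cover all \<open>n \<le> x\<close>; the summand 1 pays
    for the last, incomplete one.\<close>
  define k where "k = nat \<lfloor>x / real M\<rfloor> + 1"
  have k: "x < real (k * M)" "real k \<le> x / real M + 1"
  proof -
    have "x / real M < real k" "real k \<le> x / real M + 1"
      using assms(3) M unfolding k_def by (auto simp: nat_add_distrib) linarith+
    thus "x < real (k * M)" "real k \<le> x / real M + 1" using M by (simp_all add: field_simps)
  qed
  have "card {n. real n \<le> x \<and> exact_free S n} \<le> card {n. n < k * M \<and> exact_free S n}"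
    using k by (intro card_mono) (auto simp del: of_nat_mult)
  also have "\<dots> = k * c"
    unfolding c_def using assms(1) by (intro card_periodic exact_free_mod) (auto simp: M_def)
  finally have "real (card {n. real n \<le> x \<and> exact_free S n}) \<le> real k * real c"
    by (simp flip: of_nat_mult)
  also have "\<dots> \<le> (x / real M + 1) * real c" using k by (intro mult_right_mono) auto
  also have "\<dots> = x * (real c / real M) + real c" by (simp add: algebra_simps)
  finally have 1: "real (card {n. real n \<le> x \<and> exact_free S n}) \<le> x * (real c / real M) + real c" .
  have "c \<le> (\<Prod>p\<in>S. p\<^sup>2 - (p - 1))" unfolding c_def M_def using assms by (intro card_exact_free)
  hence "real c \<le> real (\<Prod>p\<in>S. p\<^sup>2 - (p - 1))" by (simp only: of_nat_le_iff)
  also have "\<dots> = (\<Prod>p\<in>S. (real p)\<^sup>2 - (real p - 1))"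
    unfolding of_nat_prod
  proof (rule prod.cong[OF refl])
    fix p assume "p \<in> S"
    hence "p > 3" using assms by auto
    hence "p - 1 \<le> p\<^sup>2" "1 \<le> p" by (auto simp: power2_eq_square intro: order.trans[of _ p])
    thus "real (p\<^sup>2 - (p - 1)) = (real p)\<^sup>2 - (real p - 1)" by (simp add: of_nat_diff)
  qed
  finally have "real c / real M \<le> (\<Prod>p\<in>S. (real p)\<^sup>2 - (real p - 1)) / (\<Prod>p\<in>S. (real p)\<^sup>2)"
    unfolding M_def of_nat_prod of_nat_power by (intro divide_right_mono prod_nonneg) auto
  also have "\<dots> = (\<Prod>p\<in>S. 1 - (real p - 1) / (real p)\<^sup>2)"
    unfolding prod_dividef[symmetric]
  proof (rule prod.cong[OF refl])
    fix p assume "p \<in> S"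
    hence "p > 3" using assms by auto
    thus "((real p)\<^sup>2 - (real p - 1)) / (real p)\<^sup>2 = 1 - (real p - 1) / (real p)\<^sup>2"
      by (simp add: field_simps)
  qed
  finally have "x * (real c / real M) \<le> x * (\<Prod>p\<in>S. 1 - (real p - 1) / (real p)\<^sup>2)"
    using assms(3) by (intro mult_left_mono) auto
  moreover have "c \<le> M"
    unfolding c_def by (rule order.trans[OF card_mono[of "{..<M}"]]) auto
  hence "real c \<le> (\<Prod>p\<in>S. (real p)\<^sup>2)" by (simp add: M_def flip: of_nat_power of_nat_prod)
  ultimately show ?thesis using 1 by linarith
qed

text \<open>Each factor is at most \<open>exp (- 1 / (2p))\<close>, because
  \<open>(p - 1) / p \<ge> 1/2\<close>. So it suffices that the sum of \<open>1 / p\<close> exceeds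
  \<open>- 2 * ln \<epsilon>\<close>.\<close>

lemma exact_free_density_arbitrarily_small:
  assumes "\<epsilon> > 0"
  shows "\<exists>S. finite S \<and> (\<forall>p\<in>S. prime p \<and> p mod 24 \<in> {13, 17, 19, 23}) \<and> 
     (\<Prod>p\<in>S. 1 - (real p - 1) / (real p)\<^sup>2) < \<epsilon>"
proof -
  obtain S where S: "finite S" "\<forall>p\<in>S. prime p \<and> p mod 24 \<in> {13, 17, 19, 23}" 
      "- 2 * ln \<epsilon> < (\<Sum>p\<in>S. 1 / real p)"
    using inert_reciprocals_unbounded[of "- 2 * ln \<epsilon>"] by blast
  have "(\<Prod>p\<in>S. 1 - (real p - 1) / (real p)\<^sup>2) \<le> (\<Prod>p\<in>S. exp (- (1 / 2 * (1 / real p))))"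
  proof (rule prod_mono, safe)
    fix p assume "p \<in> S"
    hence p: "p \<ge> 2" using S(2) prime_ge_2_nat by blast
    have "1 / 2 * (1 / real p) \<le> (real p - 1) / (real p)\<^sup>2"
      using p by (simp add: field_simps power2_eq_square)
    moreover have "1 - (real p - 1) / (real p)\<^sup>2 \<le> exp (- ((real p - 1) / (real p)\<^sup>2))"
      using exp_ge_add_one_self[of "- ((real p - 1) / (real p)\<^sup>2)"] by simp
    ultimately show "1 - (real p - 1) / (real p)\<^sup>2 \<le> exp (- (1 / 2 * (1 / real p)))"
      by (meson exp_le_cancel_iff neg_le_iff_le order.trans)
    have "real p * 1 \<le> real p * real p" using p by (intro mult_left_mono) auto
    hence "real p \<le> 1 + real p * real p" by linarith
    thus "0 \<le> 1 - (real p - 1) / (real p)\<^sup>2" using p by (simp add: field_simps power2_eq_square)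
  qed
  also have "\<dots> = exp (\<Sum>p\<in>S. - (1 / 2 * (1 / real p)))" by (rule exp_sum[symmetric]) (rule S)
  also have "\<dots> = exp (- (1 / 2 * (\<Sum>p\<in>S. 1 / real p)))"
    by (simp only: sum_negf sum_distrib_left)
  also have "\<dots> < exp (ln \<epsilon>)" using S(3) by simp
  also have "\<dots> = \<epsilon>" using assms by simp
  finally show ?thesis using S by blast
qed

text \<open>Half of \<open>\<epsilon>\<close> is spent on the density of the sieved set. With
  \<open>S\<close> then fixed, the other half absorbs the constant error \<open>C\<close> once
  \<open>x\<close> is large.\<close>

lemma lacunary_if_exact_free:
  assumes "\<And>S n. (\<And>p. p \<in> S \<Longrightarrow> prime p \<and> p mod 24 \<in> {13, 17, 19, 23}) \<Longrightarrow> \<not> M dvd a n \<Longrightarrow> exact_free S n"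
  shows "lacunary_mod M a"
  unfolding lacunary_mod_def
proof (rule tendstoI)
  fix \<epsilon> :: real assume \<epsilon>: "\<epsilon> > 0"
  then obtain S where S: "finite S" "\<forall>p\<in>S. prime p \<and> p mod 24 \<in> {13, 17, 19, 23}"
     "(\<Prod>p\<in>S. 1 - (real p - 1) / (real p)\<^sup>2) < \<epsilon> / 2"
    using exact_free_density_arbitrarily_small[of "\<epsilon> / 2"] by auto
  define C where "C = (\<Prod>p\<in>S. (real p)\<^sup>2)"
  have S': "prime p \<and> p > 3" if "p \<in> S" for p
  proof -
    have "p mod 24 \<noteq> p" if "p \<le> 3" using S(2) \<open>p \<in> S\<close> that by auto
    thus ?thesis using S(2) that by (cases "p \<le> 3") auto
  qed
  show "\<forall>\<^sub>F x in at_top. dist (1 / x * real (card {n. real n \<le> x \<and> \<not> M dvd a n})) 0 < \<epsilon>"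
    using eventually_gt_at_top[of "max 1 (2 * C / \<epsilon>)"]
  proof eventually_elim
    case (elim x)
    hence x: "x > 0" "C / x < \<epsilon> / 2" using \<epsilon> by (auto simp: field_simps)
    have "{n. real n \<le> x \<and> exact_free S n} \<subseteq> {..nat \<lfloor>x\<rfloor>}" by (auto simp: le_nat_floor)
    hence "finite {n. real n \<le> x \<and> exact_free S n}" by (rule finite_subset) simp
    hence "card {n. real n \<le> x \<and> \<not> M dvd a n} \<le> card {n. real n \<le> x \<and> exact_free S n}"
      using assms[of S] S(2) by (intro card_mono) auto
    hence "real (card {n. real n \<le> x \<and> \<not> M dvd a n}) \<le> x * (\<Prod>p\<in>S. 1 - (real p - 1) / (real p)\<^sup>2) + C"
      using exact_free_density[OF S(1) S' x(1)] unfolding C_def by linarith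
    hence "1 / x * real (card {n. real n \<le> x \<and> \<not> M dvd a n}) \<le> (\<Prod>p\<in>S. 1 - (real p - 1) / (real p)\<^sup>2) + C / x"
      using x(1) by (simp add: field_simps)
    hence "1 / x * real (card {n. real n \<le> x \<and> \<not> M dvd a n}) < \<epsilon>" using S(3) x(2) by linarith
    thus ?case using x(1) by (simp add: dist_real_def)
  qed
qed

theorem theorem2p1:
  shows "lacunary_mod 2 (\<lambda>n. b3 (2 * int n)) \<and>
    (\<forall>(p::nat) (c::int). prime p \<longrightarrow> p mod 24 \<in> {13, 17, 19, 23} \<longrightarrow> [24 * c = 1] (mod (int p)\<^sup>2) \<longrightarrow>
      (\<forall>n k :: nat. 1 \<le> k \<and> k \<le> p - 1 \<longrightarrow>
        [b3 (2 * ((int p)\<^sup>2 * int n + int k * int p - c)) = 0] (mod 2)))"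
proof (intro conjI allI impI)
  \<comment> \<open>Both parts rest on this: if \<open>b3 (2 * int n)\<close> is odd, an inert prime
    cannot divide \<open>24 n + 1\<close> exactly once.\<close>
  have exact: "p\<^sup>2 dvd 24 * n + 1"
    if h: "prime p" "p mod 24 \<in> {13, 17, 19, 23}" "odd (b3 (2 * int n))" "p dvd 24 * n + 1" for p n :: nat
  proof -
    obtain u v where uv: "24 * int n + 1 = u\<^sup>2 + 24 * v\<^sup>2"
      using odd_b3_imp_quadratic_form[OF h(3)] by blast
    have eq: "int (24 * n + 1) = u\<^sup>2 + 24 * v\<^sup>2" using uv by simp
    have "int p dvd int (24 * n + 1)" using h(4) by (simp only: int_dvd_int_iff)
    hence "(int p)\<^sup>2 dvd int (24 * n + 1)" unfolding eq by (rule inert_dvd_form_imp_power2_dvd[OF h(1,2)])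
    thus ?thesis by (simp only: int_dvd_int_iff flip: of_nat_power)
  qed
  thus "lacunary_mod 2 (\<lambda>n. b3 (2 * int n))"
    by (intro lacunary_if_exact_free) (auto simp: exact_free_def)
  fix p n k :: nat and c :: int
  assume p: "prime p" "p mod 24 \<in> {13, 17, 19, 23}" and c: "[24 * c = 1] (mod (int p)\<^sup>2)"
    and k: "1 \<le> k \<and> k \<le> p - 1"
  define N where "N = (int p)\<^sup>2 * int n + int k * int p - c"
  have "even (b3 (2 * N))"
  proof (rule ccontr)
    assume odd: "odd (b3 (2 * N))"
    \<comment> \<open>A negative argument gives the even value 0.\<close>
    hence "N \<ge> 0" by (auto simp: b3_def split: if_splits)
    then obtain m where m: "N = int m" using nonneg_int_cases by blast
    have "(int p)\<^sup>2 dvd 1 - 24 * c" using c by (metis cong_iff_dvd_diff cong_sym)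
    hence A: "(int p)\<^sup>2 dvd (int p)\<^sup>2 * (24 * int n) + (1 - 24 * c)" by (intro dvd_add) simp_all
    \<comment> \<open>Since \<open>24 c\<close> is 1 modulo \<open>p^2\<close>, the number
      \<open>24 N + 1\<close> is congruent to \<open>24 k p\<close>. It is therefore divisible by
      \<open>p\<close>, but not by \<open>p^2\<close> as \<open>0 < k < p\<close>.\<close>
    have N24: "int (24 * m + 1) = ((int p)\<^sup>2 * (24 * int n) + (1 - 24 * c)) + 24 * int k * int p"
      using m by (simp add: N_def algebra_simps)
    have iff: "d dvd int (24 * m + 1) \<longleftrightarrow> d dvd 24 * int k * int p" if "d dvd (int p)\<^sup>2" for d
      unfolding N24 by (rule dvd_add_right_iff) (rule dvd_trans[OF that A])
    have "int p dvd int (24 * m + 1)" by (subst iff) (auto simp: power2_eq_square)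
    hence "p dvd 24 * m + 1" by (simp only: int_dvd_int_iff)
    hence "p\<^sup>2 dvd 24 * m + 1" using exact[OF p, of m] odd m by simp
    hence "int (p\<^sup>2) dvd int (24 * m + 1)" by (simp only: int_dvd_int_iff)
    hence "(int p)\<^sup>2 dvd 24 * int k * int p" using iff by simp
    hence "int p dvd int (24 * k)" using p(1) by (simp add: power2_eq_square prime_gt_0_nat)
    hence "p dvd 24 * k" by (simp only: int_dvd_int_iff)
    hence "p dvd 24" using p(1) k by (auto simp: prime_dvd_mult_iff dest!: dvd_imp_le)
    moreover have "p > 3"
    proof (rule ccontr)
      assume "\<not> p > 3"
      hence "p mod 24 = p" by simp
      thus False using p(2) \<open>\<not> p > 3\<close> by auto
    qed
    ultimately show False using prime_gt_3_not_dvd_24[OF p(1)] by blast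
  qed
  thus "[b3 (2 * ((int p)\<^sup>2 * int n + int k * int p - c)) = 0] (mod 2)"
    by (simp add: N_def cong_0_iff)
qed

end
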